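(* Let $1<t,s<\infty$. Let $W$ be a $d\times d$ matrix weight on $\mathbb{R}^n$. Then $$\max\left([W]_{A_{t}},[W]_{RH_{t,s}}\right)^{s}\lesssim_{d,t,s}[W^{s}]_{A_{t,st}}\lesssim_{d,t,s}\left([W]_{A_{t}}[W]_{RH_{t,s}}\right)^{s}.$$
   Context: $X\lesssim_{d,t,s}Y$ means $X\leq CY$ with a constant $C>0$ depending only on $d,t,s$. $\mathbb{R}^n$ carries Lebesgue measure; $|A|$ is the spectral norm of a matrix $A$; $p'$ is the Hölder conjugate of $p$; cubes have faces parallel to the coordinate hyperplanes; $⨍$-type averages are written $\frac1{|Q|}\int_Q$. A $d\times d$ matrix weight on $\mathbb{R}^n$ is a locally integrable function $W:\mathbb{R}^n\to M_d(\mathbb{C})$ with $W(x)$ positive definite for a.e. $x$. For $1<p\leq q<\infty$ and a measurable function $V$ on $\mathbb{R}^n$ with values a.e. in the positive definite $d\times d$ complex matrices, $$[V]_{A_{p,q}}:=\sup_Q\frac1{|Q|}\int_Q\left(\frac1{|Q|}\int_Q|V(x)^{1/q}V(y)^{-1/q}|^{p'}\,\mathrm{d}y\right)^{q/p'}\mathrm{d}x\in[0,\infty],$$ supremum over all cubes $Q\subseteq\mathbb{R}^n$; and $[V]_{A_p}:=[V]_{A_{p,p}}$. For a scalar weight $w$ on $\mathbb{R}^n$ (locally integrable, a.e. positive) and $1<s<\infty$, $[w]_{RH_s}:=\sup_Q\frac{\left(\frac1{|Q|}\int_Qw^s\right)^{1/s}}{\frac1{|Q|}\int_Qw}$, supremum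 over all cubes. For a $d\times d$ matrix weight $W$, $[W]_{RH_{t,s}}:=\sup_{e\in\mathbb{C}^d\setminus\{0\}}[\,|W^{1/t}e|^{t}\,]_{RH_s}$. *)

theory Defs
  imports "HOL-Analysis.Analysis"
begin

text \<open>
  The implied constants must not depend on the dimension \<open>n\<close>, so \<open>n\<close> has to be quantified inside
  the formula. Points are therefore functions in the extensional product
  \<open>{..<n} \<rightarrow>\<^sub>E UNIV\<close> rather than elements of \<open>real ^ 'n\<close>.
\<close>

definition lebesgue_dim :: "nat \<Rightarrow> (nat \<Rightarrow> real) measure" where
  "lebesgue_dim n = completion (\<Pi>\<^sub>M i\<in>{..<n}. lborel)"

definition cubes :: "nat \<Rightarrow> (nat \<Rightarrow> real) set set" where
  "cubes n = {Q. \<exists>a h. 0 < h \<and> Q = (\<Pi>\<^sub>E i\<in>{..<n}. {a i .. a i + h})}"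

definition cadjoint :: "complex ^ 'd ^ 'd \<Rightarrow> complex ^ 'd ^ 'd" where
  "cadjoint A = (\<chi> i j. cnj (A $ j $ i))"

text \<open>
  The real inner product \<open>\<bullet>\<close> on \<open>complex ^ 'd\<close> is the real part of the Hermitian one; for
  Hermitian \<open>A\<close> the Hermitian form is real, so nothing is lost.
\<close>

definition pos_def :: "complex ^ 'd ^ 'd \<Rightarrow> bool" where
  "pos_def A \<longleftrightarrow> cadjoint A = A \<and> (\<forall>v. v \<noteq> 0 \<longrightarrow> 0 < v \<bullet> (A *v v))"

definition unitary_matrix :: "complex ^ 'd ^ 'd \<Rightarrow> bool" where
  "unitary_matrix U \<longleftrightarrow> cadjoint U ** U = mat 1 \<and> U ** cadjoint U = mat 1"

definition real_diag :: "('d \<Rightarrow> real) \<Rightarrow> complex ^ 'd ^ 'd" where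
  "real_diag l = (\<chi> i j. if i = j then complex_of_real (l i) else 0)"

text \<open>
  Real powers of a positive definite matrix by functional calculus. The result does not depend on
  the chosen diagonalisation (lemma \<open>mat_rpow_diag\<close>); the value is unspecified when \<open>A\<close> is not
  positive definite.
\<close>

definition mat_rpow :: "complex ^ 'd ^ 'd \<Rightarrow> real \<Rightarrow> complex ^ 'd ^ 'd" where
  "mat_rpow A r = (THE B. \<exists>U l. unitary_matrix U \<and> (\<forall>i. 0 < l i) \<and>
      A = U ** real_diag l ** cadjoint U \<and>
      B = U ** real_diag (\<lambda>i. l i powr r) ** cadjoint U)"

lemma real_diag_mult_left: "(real_diag l ** M) $ i $ j = complex_of_real (l i) * M $ i $ j"
proof -
  have "(real_diag l ** M) $ i $ j = (\<Sum>k\<in>UNIV. if k = i then complex_of_real (l i) * M $ k $ j else 0)"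
    unfolding matrix_matrix_mult_def real_diag_def by (simp only: vec_lambda_beta) (rule sum.cong; simp)
  then show ?thesis by simp
qed

lemma real_diag_mult_right: "(M ** real_diag l) $ i $ j = M $ i $ j * complex_of_real (l j)"
proof -
  have "(M ** real_diag l) $ i $ j = (\<Sum>k\<in>UNIV. if k = j then M $ i $ k * complex_of_real (l j) else 0)"
    unfolding matrix_matrix_mult_def real_diag_def by (simp only: vec_lambda_beta) (rule sum.cong; simp)
  then show ?thesis by simp
qed

lemma mat_rpow_diag_unique:
  assumes U: "unitary_matrix U" and V: "unitary_matrix V"
    and eq: "U ** real_diag l ** cadjoint U = V ** real_diag m ** cadjoint V"
  shows "U ** real_diag (\<lambda>i. l i powr r) ** cadjoint U = V ** real_diag (\<lambda>i. m i powr r) ** cadjoint V"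
proof -
  define M where "M = cadjoint V ** U"
  have UU: "X ** cadjoint U ** U = X" "X ** U ** cadjoint U = X" for X
    using U unfolding unitary_matrix_def by (simp_all flip: matrix_mul_assoc)
  have VV: "cadjoint V ** (V ** X) = X" "V ** (cadjoint V ** X) = X" for X
    using V unfolding unitary_matrix_def by (simp_all add: matrix_mul_assoc)
  have "cadjoint V ** (U ** real_diag l ** cadjoint U) ** U
      = cadjoint V ** (V ** real_diag m ** cadjoint V) ** U"
    by (simp only: eq)
  then have "M ** real_diag l = real_diag m ** M"
    unfolding M_def using UU VV by (metis matrix_mul_assoc)
  then have "M $ i $ j * complex_of_real (l j) = complex_of_real (m i) * M $ i $ j" for i j
    by (metis real_diag_mult_left real_diag_mult_right)
  then have "M $ i $ j = 0 \<or> l j = m i" for i j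
    by (metis mult.commute mult_cancel_left of_real_eq_iff)
  then have "M $ i $ j * complex_of_real (l j powr r) = complex_of_real (m i powr r) * M $ i $ j" for i j
    by (metis mult.commute mult_zero_left)
  then have "M ** real_diag (\<lambda>i. l i powr r) = real_diag (\<lambda>i. m i powr r) ** M"
    by (simp add: vec_eq_iff real_diag_mult_left real_diag_mult_right)
  then have "V ** (M ** real_diag (\<lambda>i. l i powr r)) ** cadjoint U
      = V ** (real_diag (\<lambda>i. m i powr r) ** M) ** cadjoint U"
    by simp
  then show ?thesis
    unfolding M_def using UU VV by (metis matrix_mul_assoc)
qed

lemma mat_rpow_diag:
  assumes "unitary_matrix U" and "\<And>i. 0 < l i"
  shows "mat_rpow (U ** real_diag l ** cadjoint U) r
    = U ** real_diag (\<lambda>i. l i powr r) ** cadjoint U"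
  unfolding mat_rpow_def
proof (rule the_equality)
  show "\<exists>V m. unitary_matrix V \<and> (\<forall>i. 0 < m i) \<and>
      U ** real_diag l ** cadjoint U = V ** real_diag m ** cadjoint V \<and>
      U ** real_diag (\<lambda>i. l i powr r) ** cadjoint U = V ** real_diag (\<lambda>i. m i powr r) ** cadjoint V"
    using assms by blast
next
  fix B
  assume "\<exists>V m. unitary_matrix V \<and> (\<forall>i. 0 < m i) \<and>
      U ** real_diag l ** cadjoint U = V ** real_diag m ** cadjoint V \<and>
      B = V ** real_diag (\<lambda>i. m i powr r) ** cadjoint V"
  then show "B = U ** real_diag (\<lambda>i. l i powr r) ** cadjoint U"
    using mat_rpow_diag_unique[OF assms(1)] by metis
qed

definition spectral_norm :: "complex ^ 'd ^ 'd \<Rightarrow> real" where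
  "spectral_norm A = onorm (\<lambda>v. A *v v)"

text \<open>
  Every point has a cube as a neighbourhood and compact sets lie in cubes, so local integrability
  is integrability on all cubes.
\<close>

definition matrix_weight :: "nat \<Rightarrow> ((nat \<Rightarrow> real) \<Rightarrow> complex ^ 'd ^ 'd) \<Rightarrow> bool" where
  "matrix_weight n W \<longleftrightarrow>
     (\<forall>Q\<in>cubes n. set_integrable (lebesgue_dim n) Q W) \<and>
     (AE x in lebesgue_dim n. pos_def (W x))"

text \<open>Only used with exponents \<open>a > 0\<close>.\<close>

definition ennpow :: "ennreal \<Rightarrow> real \<Rightarrow> ennreal" where
  "ennpow x a = (if x = \<infinity> then \<infinity> else ennreal (enn2real x powr a))"

definition cube_avg :: "nat \<Rightarrow> (nat \<Rightarrow> real) set \<Rightarrow> ((nat \<Rightarrow> real) \<Rightarrow> ennreal) \<Rightarrow> ennreal" where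
  "cube_avg n Q f = (\<integral>\<^sup>+x\<in>Q. f x \<partial>lebesgue_dim n) / emeasure (lebesgue_dim n) Q"

definition conj_exp :: "real \<Rightarrow> real" where
  "conj_exp p = p / (p - 1)"

definition Apq_char :: "nat \<Rightarrow> real \<Rightarrow> real \<Rightarrow> ((nat \<Rightarrow> real) \<Rightarrow> complex ^ 'd ^ 'd) \<Rightarrow> ennreal" where
  "Apq_char n p q V =
     (SUP Q\<in>cubes n. cube_avg n Q (\<lambda>x.
        ennpow (cube_avg n Q (\<lambda>y.
            ennreal (spectral_norm (mat_rpow (V x) (1 / q) ** mat_rpow (V y) (- 1 / q)) powr conj_exp p)))
          (q / conj_exp p)))"

abbreviation Ap_char :: "nat \<Rightarrow> real \<Rightarrow> ((nat \<Rightarrow> real) \<Rightarrow> complex ^ 'd ^ 'd) \<Rightarrow> ennreal" where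
  "Ap_char n p V \<equiv> Apq_char n p p V"

definition RH_char :: "nat \<Rightarrow> real \<Rightarrow> ((nat \<Rightarrow> real) \<Rightarrow> real) \<Rightarrow> ennreal" where
  "RH_char n s w =
     (SUP Q\<in>cubes n. ennpow (cube_avg n Q (\<lambda>x. ennreal (w x powr s))) (1 / s)
                       / cube_avg n Q (\<lambda>x. ennreal (w x)))"

definition matrix_RH_char ::
    "nat \<Rightarrow> real \<Rightarrow> real \<Rightarrow> ((nat \<Rightarrow> real) \<Rightarrow> complex ^ 'd ^ 'd) \<Rightarrow> ennreal" where
  "matrix_RH_char n t s W =
     (SUP e\<in>UNIV - {0}. RH_char n s (\<lambda>x. norm (mat_rpow (W x) (1 / t) *v e) powr t))"

end

theory Submission
  imports Defs
begin

text \<open>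
  The estimate is proved on one cube at a time, with constants that depend on neither the cube nor
  the dimension of the underlying space. Let \<open>a = W\<^bsup>1/t\<^esup>\<close>, \<open>b = W\<^bsup>-1/t\<^esup>\<close>, let \<open>t'\<close> be the exponent
  conjugate to \<open>t\<close>, and let \<open>\<Phi> x\<close> be the average over \<open>y\<close> of \<open>\<bar>a x b y\<bar>\<close> to the power \<open>t'\<close>. Since
  \<open>W\<^sup>s\<close> to the power \<open>1 / (s t)\<close> is again \<open>a\<close>, the averages that define the two Muckenhoupt
  characteristics are those of \<open>\<Phi>\<close> to the powers \<open>t / t'\<close> and \<open>s t / t'\<close>.

  The lower estimate holds with constant 1. For the \<open>A\<^sub>t\<close> part it is Jensen's inequality
  (\<open>ennpow_char_t_le\<close>). For the reverse Hoelder part, \<open>a x e = (a x b y) (a y e)\<close> and Hoelder's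
  inequality in \<open>y\<close> bound \<open>\<bar>a x e\<bar>\<close> by a power of \<open>\<Phi> x\<close> times the \<open>L\<^sup>t\<close> average of \<open>\<bar>a e\<bar>\<close>
  (\<open>norm_a_vector_le\<close>); now take the power \<open>s t\<close> and average in \<open>x\<close> (\<open>ennpow_rh_le\<close>).

  For the upper estimate, the average of \<open>\<bar>b y e\<bar>\<close> to the power \<open>t'\<close> is the power of a norm in \<open>e\<close>.
  Coordinates adapted to the unit ball of this norm, given by Auerbach's determinant argument
  (\<open>auerbach_coordinates\<close>), show that it is comparable to \<open>\<bar>B e\<bar>\<close> for a matrix \<open>B\<close>, with constants
  depending on \<open>d\<close> and \<open>t\<close> only (\<open>reducing_coordinates\<close>). Moving \<open>B\<close> to the other side of the inner
  product gives \<open>d\<close> fixed vectors \<open>v i\<close> for which \<open>\<Phi> x\<close> is comparable to the sum of the powers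
  \<open>\<bar>a x (v i)\<bar>\<^bsup>t'\<^esup>\<close> (\<open>test_directions\<close>). Hence the average of \<open>\<Phi>\<^bsup>s t / t'\<^esup>\<close> is at most a constant
  times the sum of the averages of \<open>\<bar>a (v i)\<bar>\<^bsup>s t\<^esup>\<close>, to each of which the reverse Hoelder condition
  in the direction \<open>v i\<close> applies, and the averages of \<open>\<bar>a (v i)\<bar>\<^sup>t\<close> are at most that of \<open>\<Phi>\<^bsup>t / t'\<^esup>\<close>
  (\<open>char_st_le\<close>).

  Powers of positive definite matrices are handled through the spectral theorem
  (\<open>pos_def_diagonalisation\<close>); their measurability in \<open>x\<close>, on which Hoelder's inequality and the
  additivity of the integrals rest, comes from polynomial approximation
  (\<open>borel_measurable_mat_rpow\<close>).
\<close>

section \<open>The spectral theorem for Hermitian matrices\<close>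

definition herm :: "complex ^ 'd \<Rightarrow> complex ^ 'd \<Rightarrow> complex" where
  "herm u v = (\<Sum>i\<in>UNIV. u $ i * cnj (v $ i))"

lemma inner_eq_Re_herm: "u \<bullet> v = Re (herm u v)"
  by (simp add: herm_def inner_vec_def inner_complex_def)

lemma herm_self: "herm v v = complex_of_real ((norm v)\<^sup>2)"
  unfolding herm_def norm_vec_def L2_set_def
  by (simp add: complex_mult_cnj cmod_power2 sum_nonneg)

lemma herm_swap: "herm v u = cnj (herm u v)"
  by (simp add: herm_def mult.commute)

lemma herm_scale_left: "herm (c *s u) v = c * herm u v"
  by (simp add: herm_def sum_distrib_left mult.assoc)

lemma herm_scale_right: "herm u (c *s v) = cnj c * herm u v"
  by (simp add: herm_def sum_distrib_left mult_ac)

lemma herm_diff_left: "herm (u - w) v = herm u v - herm w v"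
  by (simp add: herm_def left_diff_distrib sum_subtractf)

lemma herm_add_left: "herm (u + w) v = herm u v + herm w v"
  by (simp add: herm_def distrib_right sum.distrib)

lemma herm_matrix: "herm (A *v u) v = herm u (cadjoint A *v v)"
proof -
  have "herm (A *v u) v = (\<Sum>i\<in>UNIV. \<Sum>j\<in>UNIV. A $ i $ j * u $ j * cnj (v $ i))"
    by (simp add: herm_def matrix_vector_mult_def sum_distrib_right)
  also have "\<dots> = (\<Sum>j\<in>UNIV. \<Sum>i\<in>UNIV. A $ i $ j * u $ j * cnj (v $ i))"
    by (rule sum.swap)
  also have "\<dots> = herm u (cadjoint A *v v)"
    by (simp add: herm_def matrix_vector_mult_def cadjoint_def sum_distrib_left mult_ac)
  finally show ?thesis .
qed

lemma cmod_herm_le: "cmod (herm u v) \<le> norm u * norm v"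
proof -
  have "cmod (herm u v) \<le> (\<Sum>i\<in>UNIV. cmod (u $ i) * cmod (v $ i))"
    unfolding herm_def by (rule order_trans[OF norm_sum]) (simp add: norm_mult)
  also have "\<dots> \<le> norm u * norm v"
    unfolding norm_vec_def using L2_set_mult_ineq[of "\<lambda>i. cmod (u $ i)" "\<lambda>i. cmod (v $ i)" UNIV] by simp
  finally show ?thesis .
qed

lemma norm_vector_scale: "norm (c *s (v :: complex ^ 'd)) = cmod c * norm v"
  by (simp add: norm_vec_def norm_mult L2_set_left_distrib L2_set_right_distrib)

lemma norm_axis_one: "norm (axis j 1 :: complex ^ 'd) = 1"
  by (simp add: norm_vec_def L2_set_def axis_def if_distrib[of cmod] if_distrib[of "\<lambda>x. x\<^sup>2"] cong: if_cong)

lemma scaleR_eq_scale: "r *\<^sub>R (v :: complex ^ 'd) = complex_of_real r *s v"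
  by (simp add: vec_eq_iff complex_eq_iff)

lemma linear_matrix_vector: "linear (\<lambda>v. (A :: complex ^ 'd ^ 'd) *v v)"
  by (rule linearI) (simp_all add: matrix_vector_right_distrib scaleR_eq_scale vector_scalar_commute)

lemma bounded_linear_matrix_vector: "bounded_linear (\<lambda>v. (A :: complex ^ 'd ^ 'd) *v v)"
  by (rule linear_conv_bounded_linear[THEN iffD1, OF linear_matrix_vector])

lemma cadjoint_cadjoint [simp]: "cadjoint (cadjoint A) = A"
  by (simp add: cadjoint_def vec_eq_iff)

lemma cadjoint_mult: "cadjoint (A ** B) = cadjoint B ** cadjoint A"
  by (simp add: cadjoint_def vec_eq_iff matrix_matrix_mult_def mult.commute)

text \<open>
  A Hermitian quadratic form has a maximiser on the unit sphere of the orthogonal complement of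
  finitely many eigenvectors; by first-order optimality in every direction of that complement
  this maximiser is again an eigenvector.
\<close>

lemma hermitian_eigenvector_in_complement:
  fixes A :: "complex ^ 'd ^ 'd" and u :: "'j \<Rightarrow> complex ^ 'd"
  assumes A: "cadjoint A = A" and J: "finite J" "card J < CARD('d)"
    and u: "\<And>j. j \<in> J \<Longrightarrow> A *v u j = complex_of_real (l j) *s u j"
  shows "\<exists>v m. norm v = 1 \<and> A *v v = complex_of_real m *s v \<and> (\<forall>j\<in>J. herm v (u j) = 0)"
proof -
  define T where "T = {v. \<forall>j\<in>J. herm v (u j) = 0}"
  \<comment> \<open>Real orthogonality to both \<open>u j\<close> and \<open>\<i> u j\<close> is Hermitian orthogonality to \<open>u j\<close>.\<close>
  define B where "B = u ` J \<union> (\<lambda>j. \<i> *s u j) ` J"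
  have "card B \<le> card J + card J"
    unfolding B_def by (meson J(1) add_mono card_Un_le card_image_le order_trans)
  moreover have "dim B \<le> card B"
    using J(1) by (intro dim_le_card') (simp add: B_def)
  ultimately have "dim B < DIM(complex ^ 'd)"
    using J(2) by simp
  then obtain x where x: "x \<noteq> 0" "\<And>y. y \<in> span B \<Longrightarrow> orthogonal x y"
    using orthogonal_to_subspace_exists by metis
  have "herm x (u j) = 0" if "j \<in> J" for j
  proof (rule complex_eqI)
    show "Re (herm x (u j)) = Re 0"
      using x(2)[of "u j"] that by (simp add: B_def span_base orthogonal_def inner_eq_Re_herm)
    show "Im (herm x (u j)) = Im 0"
      using x(2)[of "\<i> *s u j"] that
      by (simp add: B_def span_base orthogonal_def inner_eq_Re_herm herm_scale_right)
  qed
  then have xT: "x \<in> T" by (simp add: T_def)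
  have T_scale: "c *s v \<in> T" if "v \<in> T" for c v
    using that by (simp add: T_def herm_scale_left)
  have T_diff: "v - w \<in> T" if "v \<in> T" "w \<in> T" for v w
    using that by (simp add: T_def herm_diff_left)
  have T_add: "v + w \<in> T" if "v \<in> T" "w \<in> T" for v w
    using that by (simp add: T_def herm_add_left)
  have T_A: "A *v v \<in> T" if "v \<in> T" for v
    using that u by (simp add: T_def herm_matrix A herm_scale_right)
  define S where "S = T \<inter> sphere 0 1"
  have "closed T"
  proof -
    have "T = (\<Inter>j\<in>J. {v. herm v (u j) = 0})" by (auto simp: T_def)
    moreover have "closed {v. herm v (u j) = 0}" for j
      unfolding herm_def by (intro closed_Collect_eq continuous_intros)
    ultimately show ?thesis by auto
  qed
  have contA: "continuous_on X (\<lambda>v. A *v v)" for X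
    using bounded_linear_matrix_vector by (rule bounded_linear.continuous_on) (rule continuous_on_id)
  have "compact S"
    unfolding S_def by (intro closed_Int_compact \<open>closed T\<close>) auto
  moreover have "complex_of_real (1 / norm x) *s x \<in> S"
    using xT x(1) T_scale by (simp add: S_def norm_vector_scale norm_divide)
  moreover have "continuous_on S (\<lambda>w. w \<bullet> (A *v w))"
    by (intro continuous_on_inner continuous_on_id contA)
  ultimately obtain v where v: "v \<in> S" "\<And>w. w \<in> S \<Longrightarrow> w \<bullet> (A *v w) \<le> v \<bullet> (A *v v)"
    using continuous_attains_sup[of S "\<lambda>w. w \<bullet> (A *v w)"] by blast
  have vT: "v \<in> T" and nv: "norm v = 1" using v(1) by (auto simp: S_def)
  define m where "m = v \<bullet> (A *v v)"
  have max: "w \<bullet> (A *v w) \<le> m * (norm w)\<^sup>2" if "w \<in> T" for w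
  proof (cases "w = 0")
    case False
    define w' where "w' = (1 / norm w) *\<^sub>R w"
    have "w' \<in> S"
      using False that T_scale by (simp add: S_def w'_def scaleR_eq_scale norm_vector_scale norm_divide)
    then have "w' \<bullet> (A *v w') \<le> m" using v(2) m_def by blast
    then have "(1 / norm w) * ((1 / norm w) * (w \<bullet> (A *v w))) \<le> m"
      unfolding w'_def using linear_cmul[OF linear_matrix_vector, of A "1 / norm w" w] by simp
    then show ?thesis using False by (simp add: field_simps power2_eq_square)
  qed simp
  \<comment> \<open>The residual \<open>w\<close> is a direction in \<open>T\<close>; comparing \<open>v\<close> with \<open>v + e w\<close> for small \<open>e\<close> shows \<open>w = 0\<close>.\<close>
  define w where "w = A *v v - complex_of_real m *s v"
  have wT: "w \<in> T" unfolding w_def by (intro T_diff T_A T_scale vT)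
  have sym: "x \<bullet> (A *v y) = y \<bullet> (A *v x)" for x y
    using herm_matrix[of A x y] inner_commute[of "A *v x" y]
    by (simp only: A inner_eq_Re_herm)
  have vv: "v \<bullet> v = 1" using nv by (simp add: dot_square_norm)
  have w_alt: "w = A *v v - m *\<^sub>R v" by (simp add: w_def scaleR_eq_scale)
  have vw: "v \<bullet> w = 0"
    using vv by (simp only: w_alt inner_diff_right inner_scaleR_right m_def mult_1_right diff_self)
  have wAv: "w \<bullet> (A *v v) = w \<bullet> w"
  proof -
    have "A *v v = w + m *\<^sub>R v" by (simp add: w_alt)
    then show ?thesis using vw by (simp only: inner_add_right inner_scaleR_right inner_commute[of w v])
  qed
  have key: "2 * e * (w \<bullet> w) \<le> e\<^sup>2 * (m * (w \<bullet> w) - w \<bullet> (A *v w))" for e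
  proof -
    have "v + e *\<^sub>R w \<in> T" using vT wT by (simp add: T_add T_scale scaleR_eq_scale)
    from max[OF this] have "(v + e *\<^sub>R w) \<bullet> (A *v (v + e *\<^sub>R w)) \<le> m * ((v + e *\<^sub>R w) \<bullet> (v + e *\<^sub>R w))"
      by (simp only: power2_norm_eq_inner)
    moreover have "A *v (v + e *\<^sub>R w) = A *v v + e *\<^sub>R (A *v w)"
      using linear_add[OF linear_matrix_vector, of A] linear_cmul[OF linear_matrix_vector, of A] by simp
    moreover have "(v + e *\<^sub>R w) \<bullet> (A *v v + e *\<^sub>R (A *v w)) = m + 2 * e * (w \<bullet> w) + e\<^sup>2 * (w \<bullet> (A *v w))"
    proof -
      have "v \<bullet> (A *v w) = w \<bullet> w" using wAv sym by metis
      then show ?thesis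
        using wAv by (simp add: inner_add_left inner_add_right flip: m_def)
          (simp add: power2_eq_square algebra_simps)
    qed
    moreover have "(v + e *\<^sub>R w) \<bullet> (v + e *\<^sub>R w) = 1 + e\<^sup>2 * (w \<bullet> w)"
      using vv vw inner_commute[of w v] by (simp add: inner_add_left inner_add_right power2_eq_square)
    ultimately have "m + 2 * e * (w \<bullet> w) + e\<^sup>2 * (w \<bullet> (A *v w)) \<le> m * (1 + e\<^sup>2 * (w \<bullet> w))"
      by simp
    then show ?thesis by (simp add: algebra_simps)
  qed
  have "w \<bullet> w = 0"
  proof (rule ccontr)
    assume "w \<bullet> w \<noteq> 0"
    then have pos: "w \<bullet> w > 0" by simp
    define c where "c = \<bar>m * (w \<bullet> w) - w \<bullet> (A *v w)\<bar> + 1"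
    define e where "e = (w \<bullet> w) / c"
    have c: "c > 0" "m * (w \<bullet> w) - w \<bullet> (A *v w) \<le> c" by (auto simp: c_def)
    have e: "e > 0" using pos c by (simp add: e_def)
    have "2 * e * (w \<bullet> w) \<le> e\<^sup>2 * c"
      using key[of e] c(2) by (meson mult_left_mono order_trans zero_le_power2)
    also have "\<dots> = e * (w \<bullet> w)" using c(1) by (simp add: e_def power2_eq_square)
    finally show False using e pos by (simp add: mult_le_cancel_right)
  qed
  then have "A *v v = complex_of_real m *s v" by (simp add: w_def)
  then show ?thesis using nv vT by (auto simp: T_def)
qed

lemma hermitian_orthonormal_eigenvectors:
  fixes A :: "complex ^ 'd ^ 'd"
  assumes A: "cadjoint A = A"
  shows "\<exists>(u :: 'd \<Rightarrow> complex ^ 'd) l. \<forall>j\<in>J. A *v u j = complex_of_real (l j) *s u j \<and>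
           (\<forall>i\<in>J. herm (u j) (u i) = (if i = j then 1 else 0))"
  using finite[of J]
proof (induction J rule: finite_induct)
  case (insert k J)
  then obtain u :: "'d \<Rightarrow> complex ^ 'd" and l where
    ul: "\<And>j. j \<in> J \<Longrightarrow> A *v u j = complex_of_real (l j) *s u j"
      "\<And>i j. i \<in> J \<Longrightarrow> j \<in> J \<Longrightarrow> herm (u j) (u i) = (if i = j then 1 else 0)"
    by blast
  have "card J < CARD('d)"
    using insert.hyps psubset_card_mono[of "UNIV :: 'd set" J] by auto
  from hermitian_eigenvector_in_complement[OF A insert.hyps(1) this, of u l] ul(1)
  obtain v m where v: "norm v = 1" "A *v v = complex_of_real m *s v" "\<And>j. j \<in> J \<Longrightarrow> herm v (u j) = 0"
    by blast
  have v': "herm (u j) v = 0" if "j \<in> J" for j using v(3)[OF that] herm_swap[of "u j" v] by simp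
  show ?case
    by (rule exI[of _ "u(k := v)"], rule exI[of _ "l(k := m)"])
      (use insert.hyps(2) ul v v' herm_self[of v] in auto)
qed simp

lemma pos_def_diagonalisation:
  fixes A :: "complex ^ 'd ^ 'd"
  assumes "pos_def A"
  shows "\<exists>U l. unitary_matrix U \<and> (\<forall>i. 0 < l i) \<and> A = U ** real_diag l ** cadjoint U"
proof -
  have A: "cadjoint A = A" using assms by (simp add: pos_def_def)
  obtain u :: "'d \<Rightarrow> complex ^ 'd" and l where
    u: "\<And>j. A *v u j = complex_of_real (l j) *s u j"
    and on: "\<And>i j. herm (u j) (u i) = (if i = j then 1 else 0)"
    using hermitian_orthonormal_eigenvectors[OF A, of UNIV] by blast
  define U where "U = (\<chi> i j. u j $ i)"
  have "cadjoint U ** U = mat 1"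
    using on by (simp add: vec_eq_iff matrix_matrix_mult_def cadjoint_def U_def mat_def herm_def mult.commute)
  then have U: "unitary_matrix U"
    using matrix_left_right_inverse unfolding unitary_matrix_def by blast
  have AU: "A ** U = U ** real_diag l"
  proof -
    have "(A ** U) $ i $ j = (A *v u j) $ i" for i j
      by (simp add: matrix_matrix_mult_def matrix_vector_mult_def U_def)
    then show ?thesis
      by (simp add: vec_eq_iff real_diag_mult_right u U_def mult.commute)
  qed
  have "A = A ** (U ** cadjoint U)" using U by (simp add: unitary_matrix_def)
  also have "\<dots> = U ** real_diag l ** cadjoint U" by (simp add: AU matrix_mul_assoc)
  finally have eq: "A = U ** real_diag l ** cadjoint U" .
  have "0 < l j" for j
  proof -
    have "u j \<noteq> 0" using on[of j j] by (auto simp: herm_def)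
    then have "0 < u j \<bullet> (A *v u j)" using assms by (auto simp: pos_def_def)
    then show ?thesis by (simp add: u inner_eq_Re_herm herm_scale_right on)
  qed
  then show ?thesis using U eq by blast
qed

section \<open>Real powers of positive definite matrices\<close>

text \<open>
  All algebraic facts about powers are read off one common diagonalisation of the base.
\<close>

lemma pos_def_mat_rpow_cases:
  assumes "pos_def A"
  obtains U l where "unitary_matrix U" "\<And>i. 0 < l i" "A = U ** real_diag l ** cadjoint U"
    "\<And>r. mat_rpow A r = U ** real_diag (\<lambda>i. l i powr r) ** cadjoint U"
  using pos_def_diagonalisation[OF assms] mat_rpow_diag by metis

lemma unitary_diag_mult:
  assumes "unitary_matrix U"
  shows "(U ** real_diag l ** cadjoint U) ** (U ** real_diag m ** cadjoint U)
    = U ** real_diag (\<lambda>i. l i * m i) ** cadjoint U"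
proof -
  have "(U ** real_diag l ** cadjoint U) ** (U ** real_diag m ** cadjoint U)
      = U ** real_diag l ** (cadjoint U ** U) ** real_diag m ** cadjoint U"
    by (simp add: matrix_mul_assoc)
  also have "\<dots> = U ** (real_diag l ** real_diag m) ** cadjoint U"
    using assms by (simp add: unitary_matrix_def matrix_mul_assoc)
  also have "real_diag l ** real_diag m = real_diag (\<lambda>i. l i * m i)"
    by (simp add: vec_eq_iff real_diag_mult_left) (simp add: real_diag_def)
  finally show ?thesis .
qed

lemma cadjoint_real_diag [simp]: "cadjoint (real_diag l) = real_diag l"
  by (simp add: cadjoint_def real_diag_def vec_eq_iff)

lemma real_diag_one: "real_diag (\<lambda>i. 1) = mat 1"
  by (simp add: real_diag_def mat_def vec_eq_iff)

lemma cadjoint_mat_rpow: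
  assumes "pos_def A" shows "cadjoint (mat_rpow A r) = mat_rpow A r"
proof -
  obtain U l where "mat_rpow A r = U ** real_diag l ** cadjoint U"
    using pos_def_mat_rpow_cases[OF assms] by metis
  then show ?thesis by (simp add: cadjoint_mult matrix_mul_assoc)
qed

lemma mat_rpow_inverse:
  assumes "pos_def A" shows "mat_rpow A r ** mat_rpow A (- r) = mat 1"
proof -
  obtain U l where U: "unitary_matrix U" "\<And>i. 0 < l i"
    "\<And>r. mat_rpow A r = U ** real_diag (\<lambda>i. l i powr r) ** cadjoint U"
    using pos_def_mat_rpow_cases[OF assms] by metis
  have "l i powr r * l i powr (- r) = 1" for i
    using U(2)[of i] by (simp add: powr_minus)
  then show ?thesis
    using U(1) by (simp add: U(3) unitary_diag_mult real_diag_one unitary_matrix_def)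
qed

lemma mat_rpow_mat_rpow:
  assumes "pos_def A" shows "mat_rpow (mat_rpow A r) q = mat_rpow A (r * q)"
proof -
  obtain U l where U: "unitary_matrix U" "\<And>i. 0 < l i"
    "\<And>r. mat_rpow A r = U ** real_diag (\<lambda>i. l i powr r) ** cadjoint U"
    using pos_def_mat_rpow_cases[OF assms] by metis
  have "mat_rpow (U ** real_diag (\<lambda>i. l i powr r) ** cadjoint U) q
      = U ** real_diag (\<lambda>i. (l i powr r) powr q) ** cadjoint U"
    by (rule mat_rpow_diag[OF U(1)]) (simp add: less_imp_neq[OF U(2), symmetric])
  then show ?thesis by (simp add: U(3) powr_powr)
qed

lemma pos_def_mat_1: "pos_def (mat 1)"
  by (simp add: pos_def_def) (simp add: cadjoint_def mat_def vec_eq_iff)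

primrec mat_pow :: "complex ^ 'd ^ 'd \<Rightarrow> nat \<Rightarrow> complex ^ 'd ^ 'd" where
  "mat_pow A 0 = mat 1"
| "mat_pow A (Suc k) = A ** mat_pow A k"

lemma continuous_on_matrix_mult:
  fixes f g :: "'a :: topological_space \<Rightarrow> complex ^ 'd ^ 'd"
  assumes "continuous_on S f" "continuous_on S g"
  shows "continuous_on S (\<lambda>x. f x ** g x)"
  unfolding matrix_matrix_mult_def using assms by (intro continuous_intros)

lemma continuous_on_mat_pow: "continuous_on S (\<lambda>A. mat_pow A k)"
  by (induction k) (simp_all add: continuous_on_matrix_mult)

lemma mat_pow_diag:
  assumes "unitary_matrix U"
  shows "mat_pow (U ** real_diag l ** cadjoint U) k = U ** real_diag (\<lambda>i. l i ^ k) ** cadjoint U"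
proof (induction k)
  case 0
  then show ?case using assms by (simp add: real_diag_one unitary_matrix_def)
qed (simp add: unitary_diag_mult[OF assms])

lemma unitary_diag_nth:
  "(U ** real_diag l ** cadjoint U) $ i $ j = (\<Sum>k\<in>UNIV. complex_of_real (l k) * (U $ i $ k * cnj (U $ j $ k)))"
  by (simp add: matrix_matrix_mult_def[of "U ** real_diag l"] real_diag_mult_right cadjoint_def mult_ac)

lemma polynomials_converge_powr:
  fixes r :: real
  shows "\<exists>(c :: nat \<Rightarrow> nat \<Rightarrow> real) N. \<forall>x>0. (\<lambda>k. \<Sum>m\<le>N k. c k m * x ^ m) \<longlonglongrightarrow> x powr r"
proof -
  have "\<exists>c N. \<forall>x\<in>{1 / real (Suc k) .. real (Suc k)}. \<bar>x powr r - (\<Sum>m\<le>(N::nat). c m * x ^ m)\<bar> < 1 / real (Suc k)" for k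
  proof -
    let ?I = "{1 / real (Suc k) .. real (Suc k)}"
    have pos: "0 < x" if "x \<in> ?I" for x
    proof -
      have "0 < 1 / real (Suc k)" by simp
      then show ?thesis using that by (meson atLeastAtMost_iff less_le_trans)
    qed
    have "continuous_on ?I (\<lambda>x. x powr r)"
      using pos by (intro continuous_intros) force
    moreover have "0 < 1 / real (Suc k)" by simp
    ultimately obtain g where "real_polynomial_function g" "\<And>x. x \<in> ?I \<Longrightarrow> \<bar>x powr r - g x\<bar> < 1 / real (Suc k)"
      using Stone_Weierstrass_real_polynomial_function[OF compact_Icc] by blast
    then show ?thesis unfolding real_polynomial_function_iff_sum by blast
  qed
  then obtain c N where cN: "\<And>k x. x \<in> {1 / real (Suc k) .. real (Suc k)} \<Longrightarrow>
      \<bar>x powr r - (\<Sum>m\<le>(N k::nat). c k m * x ^ m)\<bar> < 1 / real (Suc k)"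
    by metis
  have "(\<lambda>k. \<Sum>m\<le>N k. c k m * x ^ m) \<longlonglongrightarrow> x powr r" if x: "x > 0" for x
  proof -
    have 1: "\<forall>\<^sub>F k in sequentially. 1 / real (Suc k) < x"
      using order_tendstoD(2)[OF LIMSEQ_inverse_real_of_nat x] by (simp add: inverse_eq_divide)
    have 2: "\<forall>\<^sub>F k in sequentially. x < real (Suc k)"
      using filterlim_real_sequentially[THEN filterlim_sequentially_Suc[THEN iffD2]]
      by (simp add: filterlim_at_top_dense)
    have "\<forall>\<^sub>F k in sequentially. norm ((\<Sum>m\<le>N k. c k m * x ^ m) - x powr r) \<le> 1 / real (Suc k)"
      using 1 2
    proof eventually_elim
      case (elim k)
      then have "\<bar>x powr r - (\<Sum>m\<le>N k. c k m * x ^ m)\<bar> < 1 / real (Suc k)"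
        by (intro cN) simp
      then show ?case by simp
    qed
    moreover have "(\<lambda>k. 1 / real (Suc k)) \<longlonglongrightarrow> 0"
      using LIMSEQ_inverse_real_of_nat by (simp add: inverse_eq_divide)
    ultimately show ?thesis
      by (rule LIM_zero_cancel[OF Lim_null_comparison])
  qed
  then show ?thesis by blast
qed

text \<open>
  On positive definite matrices, \<open>A \<mapsto> A\<^sup>r\<close> is a pointwise limit of matrix polynomials with
  coefficients independent of \<open>A\<close>: polynomials that converge to \<open>x powr r\<close> at every \<open>x > 0\<close>
  converge at each eigenvalue. This gives measurability without continuity of the eigenvalues.
\<close>

lemma borel_measurable_mat_rpow:
  fixes W :: "'a \<Rightarrow> complex ^ 'd ^ 'd"
  assumes W: "W \<in> borel_measurable M" and pd: "\<And>x. x \<in> space M \<Longrightarrow> pos_def (W x)"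
  shows "(\<lambda>x. mat_rpow (W x) r) \<in> borel_measurable M"
proof -
  obtain c N where cN: "\<And>x. x > 0 \<Longrightarrow> (\<lambda>k. \<Sum>m\<le>N k. c k m * x ^ m) \<longlonglongrightarrow> x powr r"
    using polynomials_converge_powr[of r] by blast
  define p where "p k A = (\<Sum>m\<le>N k. c k m *\<^sub>R mat_pow A m)" for k and A :: "complex ^ 'd ^ 'd"
  have "continuous_on UNIV (p k)" for k
    unfolding p_def by (intro continuous_intros continuous_on_mat_pow)
  then have "(\<lambda>x. p k (W x)) \<in> borel_measurable M" for k
    using borel_measurable_continuous_on W by blast
  moreover have "(\<lambda>k. p k (W x)) \<longlonglongrightarrow> mat_rpow (W x) r" if x: "x \<in> space M" for x
  proof -
    obtain U l where U: "unitary_matrix U" "\<And>i. 0 < l i" "W x = U ** real_diag l ** cadjoint U"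
      "mat_rpow (W x) r = U ** real_diag (\<lambda>i. l i powr r) ** cadjoint U"
      using pos_def_mat_rpow_cases[OF pd[OF x]] by metis
    have "p k (W x) = U ** real_diag (\<lambda>i. \<Sum>m\<le>N k. c k m * l i ^ m) ** cadjoint U" for k
    proof -
      have "p k (W x) $ i $ j = (\<Sum>m\<le>N k. \<Sum>h\<in>UNIV. complex_of_real (c k m * l h ^ m) * (U $ i $ h * cnj (U $ j $ h)))" for i j
        by (simp add: p_def U(3) mat_pow_diag[OF U(1)] unitary_diag_nth sum_component)
          (simp only: scaleR_conv_of_real sum_distrib_left mult.assoc)
      also have "\<dots> i j = (\<Sum>h\<in>UNIV. \<Sum>m\<le>N k. complex_of_real (c k m * l h ^ m) * (U $ i $ h * cnj (U $ j $ h)))" for i j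
        by (rule sum.swap)
      finally show ?thesis
        by (simp add: vec_eq_iff unitary_diag_nth sum_distrib_right)
    qed
    moreover have "(\<lambda>k. U ** real_diag (\<lambda>i. \<Sum>m\<le>N k. c k m * l i ^ m) ** cadjoint U)
        \<longlonglongrightarrow> U ** real_diag (\<lambda>i. l i powr r) ** cadjoint U"
    proof (intro vec_tendstoI)
      show "(\<lambda>k. (U ** real_diag (\<lambda>i. \<Sum>m\<le>N k. c k m * l i ^ m) ** cadjoint U) $ i $ j)
          \<longlonglongrightarrow> (U ** real_diag (\<lambda>i. l i powr r) ** cadjoint U) $ i $ j" for i j
        unfolding unitary_diag_nth by (intro tendsto_intros cN U(2))
    qed
    ultimately show ?thesis using U(4) by simp
  qed
  ultimately show ?thesis by (rule borel_measurable_LIMSEQ_metric)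
qed

section \<open>The spectral norm\<close>

lemma norm_matrix_vector_le_spectral: "norm (A *v v) \<le> spectral_norm A * norm v"
  unfolding spectral_norm_def by (rule onorm[OF bounded_linear_matrix_vector])

lemma spectral_norm_nonneg [simp]: "0 \<le> spectral_norm A"
  unfolding spectral_norm_def by (rule onorm_pos_le[OF bounded_linear_matrix_vector])

lemma spectral_norm_least: "(\<And>v. norm (A *v v) \<le> c * norm v) \<Longrightarrow> spectral_norm A \<le> c"
  unfolding spectral_norm_def by (rule onorm_le)

lemma spectral_norm_le_norm: "spectral_norm A \<le> norm A"
proof (rule spectral_norm_least)
  fix v :: "complex ^ 'a"
  have "norm ((A *v v) $ i) \<le> norm (A $ i) * norm v" for i
  proof -
    have "norm ((A *v v) $ i) = cmod (herm (A $ i) (\<chi> j. cnj (v $ j)))"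
      by (simp add: matrix_vector_mult_def herm_def)
    also have "\<dots> \<le> norm (A $ i) * norm (\<chi> j. cnj (v $ j))" by (rule cmod_herm_le)
    also have "norm (\<chi> j. cnj (v $ j)) = norm v" by (simp add: norm_vec_def)
    finally show ?thesis .
  qed
  then have "norm (A *v v) \<le> L2_set (\<lambda>i. norm (A $ i) * norm v) UNIV"
    unfolding norm_vec_def[of "A *v v"] by (intro L2_set_mono) auto
  also have "\<dots> = norm A * norm v"
    by (simp add: norm_vec_def[of A] L2_set_left_distrib)
  finally show "norm (A *v v) \<le> norm A * norm v" .
qed

lemma spectral_norm_triangle: "spectral_norm A \<le> spectral_norm B + spectral_norm (A - B)"
proof (rule spectral_norm_least)
  fix v :: "complex ^ 'a"
  have "A *v v = B *v v + (A - B) *v v" by (simp add: matrix_vector_mult_diff_rdistrib)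
  then have "norm (A *v v) \<le> norm (B *v v) + norm ((A - B) *v v)" by (metis norm_triangle_ineq)
  also have "\<dots> \<le> spectral_norm B * norm v + spectral_norm (A - B) * norm v"
    by (intro add_mono norm_matrix_vector_le_spectral)
  finally show "norm (A *v v) \<le> (spectral_norm B + spectral_norm (A - B)) * norm v"
    by (simp add: distrib_right)
qed

lemma borel_measurable_spectral_norm [measurable]:
  "(spectral_norm :: complex ^ 'd ^ 'd \<Rightarrow> real) \<in> borel_measurable borel"
proof (rule borel_measurable_continuous_onI)
  have "dist (spectral_norm A) (spectral_norm B) \<le> 1 * dist A B" for A B :: "complex ^ 'd ^ 'd"
    using spectral_norm_triangle[of A B] spectral_norm_triangle[of B A]
      spectral_norm_le_norm[of "A - B"] spectral_norm_le_norm[of "B - A"]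
    by (simp add: dist_real_def dist_norm norm_minus_commute)
  then show "continuous_on UNIV (spectral_norm :: complex ^ 'd ^ 'd \<Rightarrow> real)"
    by (intro lipschitz_on_continuous_on[of 1]) (auto simp: lipschitz_on_def)
qed

lemma spectral_norm_cadjoint_bound: "norm (cadjoint A *v v) \<le> spectral_norm A * norm v"
proof (cases "cadjoint A *v v = 0")
  case False
  let ?w = "cadjoint A *v v"
  have "norm ?w * norm ?w = cmod (herm (A *v ?w) v)"
    by (simp add: herm_matrix herm_self power2_eq_square norm_mult)
  also have "\<dots> \<le> spectral_norm A * norm ?w * norm v"
    by (intro order_trans[OF cmod_herm_le] mult_right_mono norm_matrix_vector_le_spectral) simp
  finally show ?thesis using False by (simp add: mult_ac)
qed simp

lemma cmod_matrix_vector_nth: "cmod ((A *v v) $ j) = cmod (herm v (cadjoint A *v axis j 1))"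
proof -
  have "(A *v v) $ j = herm (A *v v) (axis j 1)"
    by (simp add: herm_def axis_def if_distrib[of cnj] if_distrib[of "\<lambda>x. _ * x"] cong: if_cong)
  then show ?thesis by (simp add: herm_matrix)
qed

lemma norm_le_sum_cmod: "norm (v :: complex ^ 'd) \<le> (\<Sum>i\<in>UNIV. cmod (v $ i))"
  unfolding norm_vec_def by (rule L2_set_le_sum) simp

text \<open>
  Passing to the adjoint turns the operator norm of \<open>A\<close> into the sizes of finitely many vectors, at
  the price of a dimensional constant.
\<close>

lemma spectral_norm_le_sum_axis: "spectral_norm A \<le> (\<Sum>j\<in>UNIV. norm (cadjoint A *v axis j 1))"
proof (rule spectral_norm_least)
  fix v :: "complex ^ 'a"
  have "norm (A *v v) \<le> (\<Sum>j\<in>UNIV. cmod ((A *v v) $ j))" by (rule norm_le_sum_cmod)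
  also have "\<dots> \<le> (\<Sum>j\<in>UNIV. norm v * norm (cadjoint A *v axis j 1))"
    unfolding cmod_matrix_vector_nth by (intro sum_mono cmod_herm_le)
  finally show "norm (A *v v) \<le> (\<Sum>j\<in>UNIV. norm (cadjoint A *v axis j 1)) * norm v"
    by (simp add: sum_distrib_left mult.commute)
qed

lemma norm_unitary:
  assumes "cadjoint U ** U = mat 1" shows "norm (U *v v) = norm v"
proof -
  have "herm (U *v v) (U *v v) = herm v v"
    by (simp add: herm_matrix matrix_vector_mul_assoc assms)
  then have "(norm (U *v v))\<^sup>2 = (norm v)\<^sup>2"
    by (simp only: herm_self of_real_eq_iff)
  then show ?thesis by simp
qed

lemma norm_mat_rpow_vector_le:
  fixes A :: "complex ^ 'd ^ 'd"
  assumes "pos_def A" "0 \<le> r"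
  shows "norm (mat_rpow A r *v v) \<le> norm A powr r * norm v"
proof -
  obtain U l where U: "unitary_matrix U" "\<And>i. 0 < l i" "A = U ** real_diag l ** cadjoint U"
    "mat_rpow A r = U ** real_diag (\<lambda>i. l i powr r) ** cadjoint U"
    using pos_def_mat_rpow_cases[OF assms(1)] by metis
  have U1: "norm (U *v w) = norm w" "norm (cadjoint U *v w) = norm w" for w
    using U(1) by (simp_all add: norm_unitary unitary_matrix_def)
  have diag_nth: "(real_diag m *v w) $ i = complex_of_real (m i) * w $ i" for m w i
    by (simp add: real_diag_def matrix_vector_mult_def if_distrib[of "\<lambda>x. x * _"] cong: if_cong)
  have l_le: "l i \<le> norm A" for i
  proof -
    have "A *v (U *v axis i 1) = U *v (real_diag l *v axis i 1)"
      using U(1) by (simp add: U(3) unitary_matrix_def matrix_vector_mul_assoc flip: matrix_mul_assoc)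
    also have "real_diag l *v axis i 1 = complex_of_real (l i) *s axis i 1"
      by (simp add: vec_eq_iff diag_nth axis_def)
    finally have "norm (A *v (U *v axis i 1)) = l i"
      using U(2)[of i] by (simp add: U1 norm_vector_scale norm_axis_one)
    moreover have "norm (A *v (U *v axis i 1)) \<le> norm A * norm (U *v axis i 1)"
      by (rule order_trans[OF norm_matrix_vector_le_spectral]) (simp add: spectral_norm_le_norm mult_right_mono)
    ultimately show ?thesis by (simp add: U1 norm_axis_one)
  qed
  have "norm (mat_rpow A r *v v) = norm (real_diag (\<lambda>i. l i powr r) *v (cadjoint U *v v))"
    by (simp add: U(4) U1(1) flip: matrix_vector_mul_assoc)
  also have "\<dots> \<le> L2_set (\<lambda>i. norm A powr r * cmod ((cadjoint U *v v) $ i)) UNIV"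
    unfolding norm_vec_def[of "real_diag m *v w" for m w]
  proof (intro L2_set_mono)
    fix i
    have "l i powr r \<le> norm A powr r"
      using l_le U(2) assms(2) by (intro powr_mono2) (auto intro: less_imp_le)
    then show "norm ((real_diag (\<lambda>i. l i powr r) *v (cadjoint U *v v)) $ i)
        \<le> norm A powr r * cmod ((cadjoint U *v v) $ i)"
      by (simp add: diag_nth norm_mult mult_right_mono)
  qed auto
  also have "\<dots> = norm A powr r * norm (cadjoint U *v v)"
    by (simp add: norm_vec_def[of "cadjoint U *v v"] L2_set_right_distrib)
  finally show ?thesis by (simp add: U1)
qed

section \<open>Powers of extended nonnegative reals and Hoelder's inequality\<close>

lemma ennpow_ennreal [simp]: "0 \<le> x \<Longrightarrow> ennpow (ennreal x) a = ennreal (x powr a)"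
  by (simp add: ennpow_def)

lemma ennpow_top [simp]: "ennpow top a = top"
  by (simp add: ennpow_def)

lemma ennpow_0 [simp]: "ennpow 0 a = 0"
  by (simp add: ennpow_def)

lemma ennpow_1 [simp]: "ennpow x 1 = x"
  by (cases x) auto

lemma ennpow_one [simp]: "ennpow 1 a = 1"
  using ennpow_ennreal[of 1 a] by simp

lemma ennpow_eq_0_iff [simp]: "ennpow x a = 0 \<longleftrightarrow> x = 0"
  by (cases x) (auto simp: ennreal_eq_0_iff dest: order.antisym)

lemma ennpow_eq_top_iff [simp]: "ennpow x a = top \<longleftrightarrow> x = top"
  by (cases x) auto

lemma ennpow_ennpow: "ennpow (ennpow x a) b = ennpow x (a * b)"
  by (cases x) (auto simp: powr_powr)

lemma ennpow_mono: "x \<le> y \<Longrightarrow> 0 \<le> a \<Longrightarrow> ennpow x a \<le> ennpow y a"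
  by (cases x; cases y) (auto simp: top_unique intro!: ennreal_leI powr_mono2)

lemma ennpow_mult: "ennpow (x * y) a = ennpow x a * ennpow y a"
proof (cases "x = top \<or> y = top")
  case True
  then show ?thesis by (cases "x = 0 \<or> y = 0") (auto simp: ennreal_mult_eq_top_iff ennreal_top_mult ennreal_mult_top)
next
  case False
  then obtain u v where "x = ennreal u" "y = ennreal v" "0 \<le> u" "0 \<le> v"
    by (metis ennreal_cases)
  then show ?thesis by (simp add: powr_mult flip: ennreal_mult)
qed

lemma borel_measurable_ennpow [measurable (raw)]:
  assumes "f \<in> borel_measurable M"
  shows "(\<lambda>x. ennpow (f x) a) \<in> borel_measurable M"
  unfolding ennpow_def using assms by measurable

lemma ennpow_sum_le:
  assumes "finite I" "0 \<le> a"
  shows "ennpow (\<Sum>i\<in>I. x i) a \<le> ennreal (real (card I) powr a) * (\<Sum>i\<in>I. ennpow (x i) a)"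
proof (cases "I = {}")
  case False
  obtain k where k: "k \<in> I" "\<And>i. i \<in> I \<Longrightarrow> x i \<le> x k"
    using finite_has_maximal[of "x ` I"] assms(1) False
    by (metis (no_types, opaque_lifting) finite_imageI image_is_empty imageE image_eqI linorder_le_cases order.antisym)
  have "(\<Sum>i\<in>I. x i) \<le> ennreal (real (card I)) * x k"
    using sum_bounded_above[of I x "x k"] k(2) by (simp add: ennreal_of_nat_eq_real_of_nat)
  then have "ennpow (\<Sum>i\<in>I. x i) a \<le> ennpow (ennreal (real (card I)) * x k) a"
    by (rule ennpow_mono) (rule assms(2))
  also have "\<dots> = ennreal (real (card I) powr a) * ennpow (x k) a"
    by (simp add: ennpow_mult)
  also have "\<dots> \<le> ennreal (real (card I) powr a) * (\<Sum>i\<in>I. ennpow (x i) a)"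
    using assms(1) k(1) by (intro mult_left_mono member_le_sum) auto
  finally show ?thesis .
qed simp

lemma Youngs_inequality_ennreal:
  assumes "p > 1" "q > 1" "1/p + 1/q = 1"
  shows "x * y \<le> ennreal (1/p) * ennpow x p + ennreal (1/q) * ennpow y q"
proof (cases "x = top \<or> y = top")
  case True
  then show ?thesis using assms by (auto simp: ennreal_mult_top)
next
  case False
  then obtain u v where uv: "x = ennreal u" "y = ennreal v" "0 \<le> u" "0 \<le> v"
    by (metis ennreal_cases)
  then have "x * y = ennreal (u * v)" by (simp add: ennreal_mult)
  also have "\<dots> \<le> ennreal (1/p * u powr p + 1/q * v powr q)"
    using Youngs_inequality[OF assms uv(3,4)] by (intro ennreal_leI) simp
  also have "\<dots> = ennreal (1/p) * ennpow x p + ennreal (1/q) * ennpow y q"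
  proof -
    have "ennreal (1/p * u powr p + 1/q * v powr q) = ennreal (1/p * u powr p) + ennreal (1/q * v powr q)"
      using assms by (intro ennreal_plus) auto
    also have "ennreal (1/p * u powr p) = ennreal (1/p) * ennpow x p"
      using assms uv by (subst ennreal_mult) simp_all
    also have "ennreal (1/q * v powr q) = ennreal (1/q) * ennpow y q"
      using assms uv by (subst ennreal_mult) simp_all
    finally show ?thesis .
  qed
  finally show ?thesis .
qed

lemma nn_integral_Hoelder:
  assumes pq: "p > 1" "q > 1" "1/p + 1/q = 1"
    and f: "f \<in> borel_measurable M" and g: "g \<in> borel_measurable M"
  shows "(\<integral>\<^sup>+x. f x * g x \<partial>M)
    \<le> ennpow (\<integral>\<^sup>+x. ennpow (f x) p \<partial>M) (1/p) * ennpow (\<integral>\<^sup>+x. ennpow (g x) q \<partial>M) (1/q)"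
    (is "_ \<le> ennpow ?F _ * ennpow ?G _")
proof -
  note [measurable] = f g
  consider "?F = 0 \<or> ?G = 0" | "?F \<noteq> 0" "?G \<noteq> 0" "?F = top \<or> ?G = top"
    | "?F \<noteq> 0" "?G \<noteq> 0" "?F \<noteq> top" "?G \<noteq> top" by blast
  then show ?thesis
  proof cases
    \<comment> \<open>Here the right-hand side may be \<open>0 * \<infinity> = 0\<close>, but the integrand on the left vanishes too.\<close>
    case 1
    then have "(AE x in M. f x = 0) \<or> (AE x in M. g x = 0)"
      by (simp add: nn_integral_0_iff_AE)
    then have "AE x in M. f x * g x = 0" by auto
    then have "(\<integral>\<^sup>+x. f x * g x \<partial>M) = 0" by (simp add: nn_integral_0_iff_AE)
    then show ?thesis by simp
  next
    case 2
    then have "ennpow ?F (1/p) * ennpow ?G (1/q) = top"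
      by (auto simp: ennreal_mult_eq_top_iff)
    then show ?thesis by simp
  next
    case 3
    then obtain F G where FG: "?F = ennreal F" "?G = ennreal G" "0 < F" "0 < G"
      by (metis ennreal_cases ennreal_0 order_le_less)
    define \<alpha> \<beta> where "\<alpha> = F powr (1/p)" and "\<beta> = G powr (1/q)"
    have pos: "0 < \<alpha>" "0 < \<beta>" using FG by (auto simp: \<alpha>_def \<beta>_def)
    have \<alpha>p: "(1/\<alpha>) powr p = 1/F" and \<beta>q: "(1/\<beta>) powr q = 1/G"
      using FG pq by (auto simp: \<alpha>_def \<beta>_def powr_divide powr_powr)
    have "(\<integral>\<^sup>+x. f x * g x \<partial>M) = (\<integral>\<^sup>+x. ennreal (\<alpha> * \<beta>) * ((ennreal (1/\<alpha>) * f x) * (ennreal (1/\<beta>) * g x)) \<partial>M)"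
    proof (rule nn_integral_cong)
      fix x
      have "ennreal (\<alpha> * \<beta>) * ennreal (1/\<alpha>) * ennreal (1/\<beta>) = 1"
        using pos by (simp flip: ennreal_mult)
      then show "f x * g x = ennreal (\<alpha> * \<beta>) * ((ennreal (1/\<alpha>) * f x) * (ennreal (1/\<beta>) * g x))"
        by (metis mult.assoc mult.commute mult.left_neutral)
    qed
    also have "\<dots> = ennreal (\<alpha> * \<beta>) * (\<integral>\<^sup>+x. (ennreal (1/\<alpha>) * f x) * (ennreal (1/\<beta>) * g x) \<partial>M)"
      by (rule nn_integral_cmult) measurable
    also have "(\<integral>\<^sup>+x. (ennreal (1/\<alpha>) * f x) * (ennreal (1/\<beta>) * g x) \<partial>M)
        \<le> (\<integral>\<^sup>+x. ennreal (1/p) * (ennreal (1/F) * ennpow (f x) p) + ennreal (1/q) * (ennreal (1/G) * ennpow (g x) q) \<partial>M)"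
    proof (rule nn_integral_mono)
      fix x
      have "(ennreal (1/\<alpha>) * f x) * (ennreal (1/\<beta>) * g x)
          \<le> ennreal (1/p) * ennpow (ennreal (1/\<alpha>) * f x) p + ennreal (1/q) * ennpow (ennreal (1/\<beta>) * g x) q"
        by (rule Youngs_inequality_ennreal[OF pq])
      also have "\<dots> = ennreal (1/p) * (ennreal (1/F) * ennpow (f x) p) + ennreal (1/q) * (ennreal (1/G) * ennpow (g x) q)"
        using pos \<alpha>p \<beta>q by (simp add: ennpow_mult)
      finally show "(ennreal (1/\<alpha>) * f x) * (ennreal (1/\<beta>) * g x)
          \<le> ennreal (1/p) * (ennreal (1/F) * ennpow (f x) p) + ennreal (1/q) * (ennreal (1/G) * ennpow (g x) q)" .
    qed
    also have "\<dots> = ennreal (1/p) * (ennreal (1/F) * ?F) + ennreal (1/q) * (ennreal (1/G) * ?G)"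
      by (simp add: nn_integral_add nn_integral_cmult)
    also have "\<dots> = ennreal (1/p) + ennreal (1/q)"
      using FG by (simp flip: ennreal_mult)
    also have "\<dots> = 1" using pq by (simp flip: ennreal_plus)
    finally have "(\<integral>\<^sup>+x. f x * g x \<partial>M) \<le> ennreal (\<alpha> * \<beta>)"
      by (simp add: mult_left_mono)
    also have "\<dots> = ennpow ?F (1/p) * ennpow ?G (1/q)"
      using FG pos by (simp add: \<alpha>_def \<beta>_def ennreal_mult)
    finally show ?thesis .
  qed
qed

lemma ennpow_nn_integral_le:
  assumes M: "emeasure M (space M) = 1" and s: "1 < s" and f: "f \<in> borel_measurable M"
  shows "ennpow (\<integral>\<^sup>+x. f x \<partial>M) s \<le> (\<integral>\<^sup>+x. ennpow (f x) s \<partial>M)"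
proof -
  have conj: "conj_exp s > 1" "1/s + 1/conj_exp s = 1"
    using s by (auto simp: conj_exp_def field_simps)
  have "(\<integral>\<^sup>+x. f x * 1 \<partial>M) \<le> ennpow (\<integral>\<^sup>+x. ennpow (f x) s \<partial>M) (1/s) * ennpow (\<integral>\<^sup>+x. ennpow 1 (conj_exp s) \<partial>M) (1/conj_exp s)"
    by (rule nn_integral_Hoelder[OF s conj f]) simp
  then have "(\<integral>\<^sup>+x. f x \<partial>M) \<le> ennpow (\<integral>\<^sup>+x. ennpow (f x) s \<partial>M) (1/s)"
    by (simp add: M)
  then have "ennpow (\<integral>\<^sup>+x. f x \<partial>M) s \<le> ennpow (ennpow (\<integral>\<^sup>+x. ennpow (f x) s \<partial>M) (1/s)) s"
    using s by (intro ennpow_mono) auto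
  then show ?thesis using s by (simp add: ennpow_ennpow)
qed

section \<open>Auerbach coordinates\<close>

text \<open>
  Among the matrices whose columns lie in \<open>S\<close> choose one, \<open>M\<close>, of maximal modulus of the
  determinant. By Cramer's rule the coordinates of \<open>e \<in> S\<close> with respect to the columns of \<open>M\<close> are
  quotients of determinants of two such matrices, with \<open>det M\<close> in the denominator.
\<close>

lemma auerbach_coordinates:
  fixes S :: "(complex ^ 'd) set"
  assumes S: "compact S" and r: "0 < r" "ball 0 r \<subseteq> S"
  shows "\<exists>M B :: complex ^ 'd ^ 'd. M ** B = mat 1 \<and> (\<forall>j. column j M \<in> S) \<and>
           (\<forall>e\<in>S. \<forall>i. cmod ((B *v e) $ i) \<le> 1)"
proof -
  define K where "K = {M :: complex ^ 'd ^ 'd. \<forall>j. column j M \<in> S}"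
  have cont_column: "continuous_on UNIV (\<lambda>M :: complex ^ 'd ^ 'd. column j M)" for j
    unfolding column_def by (intro continuous_intros)
  have "closed K"
  proof -
    have "K = (\<Inter>j. (\<lambda>M. column j M) -` S)" by (auto simp: K_def)
    moreover have "closed ((\<lambda>M :: complex ^ 'd ^ 'd. column j M) -` S)" for j
      using cont_column compact_imp_closed[OF S] by (metis closed_vimage)
    ultimately show ?thesis by auto
  qed
  moreover have "bounded K"
  proof -
    obtain c where c: "\<And>v. v \<in> S \<Longrightarrow> norm v \<le> c"
      using compact_imp_bounded[OF S] by (auto simp: bounded_iff)
    have "norm M \<le> (\<Sum>i\<in>(UNIV::'d set). \<Sum>j\<in>(UNIV::'d set). c)" if "M \<in> K" for M
    proof -
      have "norm M \<le> (\<Sum>i\<in>UNIV. norm (M $ i))"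
        unfolding norm_vec_def[of M] by (rule L2_set_le_sum) simp
      also have "\<dots> \<le> (\<Sum>i\<in>UNIV. \<Sum>j\<in>UNIV. cmod (M $ i $ j))"
        by (intro sum_mono norm_le_sum_cmod)
      also have "\<dots> \<le> (\<Sum>i\<in>(UNIV::'d set). \<Sum>j\<in>(UNIV::'d set). c)"
      proof (intro sum_mono)
        fix i j
        have "cmod (M $ i $ j) = cmod (column j M $ i)" by (simp add: column_def)
        also have "\<dots> \<le> norm (column j M)" by (rule Finite_Cartesian_Product.norm_nth_le)
        also have "\<dots> \<le> c" using that c by (simp add: K_def)
        finally show "cmod (M $ i $ j) \<le> c" .
      qed
      finally show ?thesis .
    qed
    then show ?thesis by (auto simp: bounded_iff)
  qed
  ultimately have "compact K" by (simp add: compact_eq_bounded_closed)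
  moreover define M0 :: "complex ^ 'd ^ 'd" where "M0 = real_diag (\<lambda>_. r / 2)"
  have M0: "M0 \<in> K"
  proof -
    have "column j M0 = complex_of_real (r / 2) *s axis j 1" for j
      by (simp add: vec_eq_iff column_def M0_def real_diag_def axis_def)
    then have half: "norm (column j M0) = r / 2" for j
      using r(1) by (simp add: norm_axis_one norm_vector_scale norm_divide)
    have "norm (column j M0) < r" for j
      unfolding half using r(1) by simp
    then have "column j M0 \<in> ball 0 r" for j by simp
    then show ?thesis using r(2) by (auto simp: K_def)
  qed
  moreover have "continuous_on K (\<lambda>M. cmod (det M))"
    unfolding det_def by (intro continuous_intros)
  ultimately obtain M where M: "M \<in> K" "\<And>N. N \<in> K \<Longrightarrow> cmod (det N) \<le> cmod (det M)"
    using continuous_attains_sup[of K "\<lambda>M. cmod (det M)"] by blast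
  have "det M0 = (\<Prod>i\<in>(UNIV::'d set). complex_of_real (r / 2))"
    unfolding M0_def by (subst det_diagonal) (simp_all add: real_diag_def)
  then have "0 < cmod (det M0)" using r(1) by simp
  then have det: "0 < cmod (det M)" using M(2)[OF M0] by linarith
  then obtain B where B: "M ** B = mat 1"
    using invertible_det_nz[of M] by (auto simp: invertible_def)
  have "cmod ((B *v e) $ k) \<le> 1" if e: "e \<in> S" for e k
  proof -
    let ?N = "(\<chi> i j. if j = k then (M *v (B *v e)) $ i else M $ i $ j) :: complex ^ 'd ^ 'd"
    have "M *v (B *v e) = e" by (simp add: matrix_vector_mul_assoc B)
    then have "column j ?N = (if j = k then e else column j M)" for j
      by (simp add: vec_eq_iff column_def)
    then have "?N \<in> K" using e M(1) by (simp add: K_def)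
    then have "cmod (det ?N) \<le> cmod (det M)" by (rule M(2))
    moreover have "det ?N = (B *v e) $ k * det M" by (rule cramer_lemma)
    ultimately have "cmod ((B *v e) $ k * det M) \<le> cmod (det M)" by simp
    then show ?thesis using det by (simp add: norm_mult)
  qed
  then show ?thesis using B M(1) by (auto simp: K_def)
qed

section \<open>A matrix weight on a probability space\<close>

text \<open>
  Here \<open>d\<close> is the size of the matrices. Inside the power, \<open>d\<close> to the exponent \<open>conj_exp t\<close> is lost
  once in the spectral norm and once in the expansion in coordinates, one factor \<open>d\<close> counts the
  terms of the former expansion, and one is lost when a sum of \<open>d\<close> terms is raised to that power; the
  last factor counts the test directions.
\<close>

definition upper_const :: "real \<Rightarrow> real \<Rightarrow> real \<Rightarrow> real" where
  "upper_const d t s = (d powr conj_exp t * d powr conj_exp t * d * d) powr (s * t / conj_exp t) * d"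

lemma upper_const_pos: "0 < d \<Longrightarrow> 0 < upper_const d t s"
  by (simp add: upper_const_def)

text \<open>
  The model is a cube with normalised Lebesgue measure. There \<open>char_t\<close> and \<open>char_st\<close> are the averages
  whose suprema over cubes are \<open>[W]\<close> in \<open>A\<^sub>t\<close> and \<open>[W\<^sup>s]\<close> in \<open>A\<^sub>t\<^sub>,\<^sub>s\<^sub>t\<close>; both are integrals of powers of
  the same function \<open>\<Phi>\<close>, because \<open>(W\<^sup>s)\<close> to the power \<open>1 / (s t)\<close> is \<open>W\<close> to the power \<open>1 / t\<close>. The
  quotient in the reverse Hoelder condition is \<open>rh\<close>, and \<open>g\<close> is the power of the averaged dual norm
  that has to be linearised.
\<close>

locale weight_on_prob =
  fixes M :: "'x measure" and W :: "'x \<Rightarrow> complex ^ 'd ^ 'd" and t s :: real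
  assumes emeasure_space: "emeasure M (space M) = 1"
    and integrable: "integrable M W"
    and pos_def: "\<And>x. pos_def (W x)"
    and t: "1 < t" and s: "1 < s"
begin

abbreviation t' :: real where "t' \<equiv> conj_exp t"

definition a :: "'x \<Rightarrow> complex ^ 'd ^ 'd" where "a x = mat_rpow (W x) (1 / t)"
definition b :: "'x \<Rightarrow> complex ^ 'd ^ 'd" where "b x = mat_rpow (W x) (- (1 / t))"

definition \<Phi> :: "'x \<Rightarrow> ennreal" where
  "\<Phi> x = (\<integral>\<^sup>+y. ennreal (spectral_norm (a x ** b y) powr t') \<partial>M)"
definition char_t :: ennreal where "char_t = (\<integral>\<^sup>+x. ennpow (\<Phi> x) (t / t') \<partial>M)"
definition char_st :: ennreal where "char_st = (\<integral>\<^sup>+x. ennpow (\<Phi> x) (s * t / t') \<partial>M)"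

definition I :: "complex ^ 'd \<Rightarrow> ennreal" where
  "I e = (\<integral>\<^sup>+x. ennreal (norm (a x *v e) powr t) \<partial>M)"
definition J :: "complex ^ 'd \<Rightarrow> ennreal" where
  "J e = (\<integral>\<^sup>+x. ennreal ((norm (a x *v e) powr t) powr s) \<partial>M)"
definition rh :: "complex ^ 'd \<Rightarrow> ennreal" where "rh e = ennpow (J e) (1 / s) / I e"

definition g :: "complex ^ 'd \<Rightarrow> ennreal" where
  "g e = (\<integral>\<^sup>+y. ennreal (norm (b y *v e) powr t') \<partial>M)"

lemma t': "1 < t'" "1 / t' + 1 / t = 1" "1 / t + 1 / t' = 1"
  using t by (auto simp: conj_exp_def field_simps)

lemma measurable_weight [measurable]: "W \<in> borel_measurable M"
  using integrable by simp

lemma measurable_a [measurable]: "a \<in> borel_measurable M"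
  and measurable_b [measurable]: "b \<in> borel_measurable M"
  using borel_measurable_mat_rpow[OF measurable_weight pos_def]
  by (simp_all add: a_def[abs_def] b_def[abs_def])

lemma measurable_matrix_mult [measurable (raw)]:
  fixes f h :: "'y \<Rightarrow> complex ^ 'd ^ 'd"
  assumes "f \<in> borel_measurable N" "h \<in> borel_measurable N"
  shows "(\<lambda>x. f x ** h x) \<in> borel_measurable N"
  using assms
  by (rule borel_measurable_continuous_Pair)
    (intro continuous_on_matrix_mult continuous_on_fst continuous_on_snd continuous_on_id)

lemma measurable_matrix_vector [measurable (raw)]:
  fixes f :: "'y \<Rightarrow> complex ^ 'd ^ 'd"
  assumes "f \<in> borel_measurable N"
  shows "(\<lambda>x. f x *v e) \<in> borel_measurable N"
  using borel_measurable_continuous_on[OF _ assms, of "\<lambda>A. A *v e"]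
  unfolding matrix_vector_mult_def by (simp add: continuous_intros)

lemma measurable_spectral_norm [measurable (raw)]:
  fixes f :: "'y \<Rightarrow> complex ^ 'd ^ 'd"
  assumes "f \<in> borel_measurable N"
  shows "(\<lambda>x. spectral_norm (f x)) \<in> borel_measurable N"
  using measurable_compose[OF assms borel_measurable_spectral_norm] .

lemma measurable_\<Phi> [measurable]: "\<Phi> \<in> borel_measurable M"
proof -
  interpret finite_measure M
    by (rule finite_measureI) (simp add: emeasure_space)
  have "(\<lambda>x. \<integral>\<^sup>+y. ennreal (spectral_norm (a x ** b y) powr t') \<partial>M) \<in> borel_measurable M"
    by measurable
  then show ?thesis by (simp add: \<Phi>_def[abs_def])
qed

lemma cadjoint_a: "cadjoint (a x) = a x" and cadjoint_b: "cadjoint (b x) = b x"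
  by (simp_all add: a_def b_def cadjoint_mat_rpow pos_def)

lemma a_mult_b: "a x ** b x = mat 1" and b_mult_a: "b x ** a x = mat 1"
  using mat_rpow_inverse[OF pos_def, of x "1 / t"] mat_rpow_inverse[OF pos_def, of x "- (1 / t)"]
  by (simp_all add: a_def b_def)

lemma a_b_vector: "a x *v (b x *v e) = e" and b_a_vector: "b x *v (a x *v e) = e"
  by (simp_all add: matrix_vector_mul_assoc a_mult_b b_mult_a)

lemma norm_a_vector_pos: "e \<noteq> 0 \<Longrightarrow> 0 < norm (a x *v e)"
  using b_a_vector[of x e] by (metis matrix_vector_mult_0_right zero_less_norm_iff)

lemma ennpow_char_t_le: "ennpow char_t s \<le> char_st"
proof -
  have "ennpow char_t s \<le> (\<integral>\<^sup>+x. ennpow (ennpow (\<Phi> x) (t / t')) s \<partial>M)"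
    unfolding char_t_def using emeasure_space s by (rule ennpow_nn_integral_le) measurable
  then show ?thesis by (simp add: char_st_def ennpow_ennpow mult.commute)
qed

text \<open>
  Writing \<open>a x = (a x) (b y) (a y)\<close> and averaging over \<open>y\<close> bounds \<open>\<bar>a x e\<bar>\<close> pointwise in \<open>x\<close>.
\<close>

lemma norm_a_vector_le: "ennreal (norm (a x *v e)) \<le> ennpow (\<Phi> x) (1 / t') * ennpow (I e) (1 / t)"
proof -
  have "ennreal (norm (a x *v e)) = (\<integral>\<^sup>+y. ennreal (norm (a x *v e)) \<partial>M)"
    by (simp add: emeasure_space)
  also have "\<dots> \<le> (\<integral>\<^sup>+y. ennreal (spectral_norm (a x ** b y)) * ennreal (norm (a y *v e)) \<partial>M)"
  proof (rule nn_integral_mono)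
    fix y
    have "a x *v e = (a x ** b y) *v (a y *v e)"
      by (simp add: b_a_vector flip: matrix_vector_mul_assoc)
    then show "ennreal (norm (a x *v e)) \<le> ennreal (spectral_norm (a x ** b y)) * ennreal (norm (a y *v e))"
      by (metis ennreal_leI ennreal_mult' norm_matrix_vector_le_spectral spectral_norm_nonneg)
  qed
  also have "\<dots> \<le> ennpow (\<integral>\<^sup>+y. ennpow (ennreal (spectral_norm (a x ** b y))) t' \<partial>M) (1 / t')
      * ennpow (\<integral>\<^sup>+y. ennpow (ennreal (norm (a y *v e))) t \<partial>M) (1 / t)"
    by (rule nn_integral_Hoelder[OF t'(1) t t'(2)]) measurable
  finally show ?thesis by (simp add: \<Phi>_def I_def)
qed

lemma J_le: "J e \<le> char_st * ennpow (I e) s"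
proof -
  have "J e \<le> (\<integral>\<^sup>+x. ennpow (\<Phi> x) (s * t / t') * ennpow (I e) s \<partial>M)"
    unfolding J_def
  proof (rule nn_integral_mono)
    fix x
    have "ennreal ((norm (a x *v e) powr t) powr s) = ennpow (ennreal (norm (a x *v e))) (t * s)"
      by (simp add: powr_powr)
    also have "\<dots> \<le> ennpow (ennpow (\<Phi> x) (1 / t') * ennpow (I e) (1 / t)) (t * s)"
      using t s by (intro ennpow_mono norm_a_vector_le) simp
    also have "\<dots> = ennpow (\<Phi> x) (s * t / t') * ennpow (I e) s"
      using t by (simp add: ennpow_mult ennpow_ennpow mult.commute)
    finally show "ennreal ((norm (a x *v e) powr t) powr s) \<le> ennpow (\<Phi> x) (s * t / t') * ennpow (I e) s" .
  qed
  also have "\<dots> = char_st * ennpow (I e) s"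
    unfolding char_st_def by (rule nn_integral_multc) measurable
  finally show ?thesis .
qed

text \<open>
  With the conventions of \<open>ennreal\<close> the quotient \<open>rh e\<close> is \<open>0\<close> if \<open>I e\<close> is infinite, and also if
  \<open>I e = 0\<close>, since then \<open>J e = 0\<close>.
\<close>

lemma ennpow_rh_le: "ennpow (rh e) s \<le> char_st"
proof -
  consider "I e = top" | "I e = 0" | "I e \<noteq> 0" "I e \<noteq> top" by blast
  then show ?thesis
  proof cases
    case 1
    then show ?thesis by (simp add: rh_def divide_ennreal_def)
  next
    case 2
    then have "J e = 0" using J_le[of e] by simp
    then show ?thesis by (simp add: rh_def)
  next
    case 3
    have "ennpow (rh e) s * ennpow (I e) s = ennpow (rh e * I e) s"
      by (simp add: ennpow_mult)
    also have "rh e * I e = ennpow (J e) (1 / s)"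
      unfolding rh_def using 3 by (simp add: ennreal_divide_times top.not_eq_extremum)
    also have "ennpow (ennpow (J e) (1 / s)) s = J e" using s by (simp add: ennpow_ennpow)
    also have "\<dots> \<le> char_st * ennpow (I e) s" by (rule J_le)
    finally show ?thesis
      using 3 by (metis ennreal_mult_le_mult_iff ennpow_eq_0_iff ennpow_eq_top_iff mult.commute)
  qed
qed

lemma nn_integral_norm_a_finite: "(\<integral>\<^sup>+x. ennreal (spectral_norm (a x) powr t) \<partial>M) < top"
proof -
  have "(\<integral>\<^sup>+x. ennreal (spectral_norm (a x) powr t) \<partial>M) \<le> (\<integral>\<^sup>+x. ennreal (norm (W x)) \<partial>M)"
  proof (rule nn_integral_mono)
    fix x
    have "spectral_norm (a x) \<le> norm (W x) powr (1 / t)"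
      unfolding a_def using t by (intro spectral_norm_least norm_mat_rpow_vector_le pos_def) simp
    then have "spectral_norm (a x) powr t \<le> (norm (W x) powr (1 / t)) powr t"
      using t by (intro powr_mono2) auto
    then show "ennreal (spectral_norm (a x) powr t) \<le> ennreal (norm (W x))"
      using t by (simp add: powr_powr)
  qed
  also have "\<dots> < top"
    using integrable by (simp add: integrable_iff_bounded top.not_eq_extremum)
  finally show ?thesis .
qed

lemma I_finite: "I e < top"
proof -
  have "I e \<le> (\<integral>\<^sup>+x. ennreal (spectral_norm (a x) powr t) * ennreal (norm e powr t) \<partial>M)"
    unfolding I_def
  proof (rule nn_integral_mono)
    fix x
    have "norm (a x *v e) powr t \<le> (spectral_norm (a x) * norm e) powr t"
      using t by (intro powr_mono2 norm_matrix_vector_le_spectral) auto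
    then show "ennreal (norm (a x *v e) powr t) \<le> ennreal (spectral_norm (a x) powr t) * ennreal (norm e powr t)"
      by (simp add: powr_mult flip: ennreal_mult)
  qed
  also have "\<dots> = (\<integral>\<^sup>+x. ennreal (spectral_norm (a x) powr t) \<partial>M) * ennreal (norm e powr t)"
    by (rule nn_integral_multc) measurable
  also have "\<dots> < top"
    using nn_integral_norm_a_finite by (simp add: ennreal_mult_less_top)
  finally show ?thesis .
qed

lemma I_pos:
  assumes "e \<noteq> 0" shows "I e \<noteq> 0"
proof
  assume "I e = 0"
  then have "AE x in M. ennreal (norm (a x *v e) powr t) = 0"
    unfolding I_def by (subst (asm) nn_integral_0_iff_AE) measurable
  then have "AE x in M. False"
    by (rule AE_mp) (use norm_a_vector_pos[OF assms] in \<open>auto simp: ennreal_eq_0_iff intro!: AE_I2\<close>)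
  then have "emeasure M (space M) = 0"
    by (simp add: eventually_False ae_filter_eq_bot_iff)
  then show False by (simp add: emeasure_space)
qed

lemma J_eq:
  assumes "e \<noteq> 0" shows "J e = ennpow (rh e * I e) s"
proof -
  have "rh e * I e = ennpow (J e) (1 / s)"
    unfolding rh_def using I_pos[OF assms] I_finite by (simp add: ennreal_divide_times)
  then show ?thesis using s by (simp add: ennpow_ennpow)
qed

lemma rh_nonzero:
  assumes "e \<noteq> 0" shows "rh e \<noteq> 0"
proof
  assume "rh e = 0"
  then have "J e = 0" using J_eq[OF assms] by simp
  moreover have "ennpow (I e) s \<le> J e"
    using ennpow_nn_integral_le[OF emeasure_space s, of "\<lambda>x. ennreal (norm (a x *v e) powr t)"]
    by (simp add: I_def J_def)
  ultimately show False using I_pos[OF assms] by simp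
qed

text \<open>
  By self-adjointness \<open>b y e\<close> is the adjoint of \<open>(a x) (b y)\<close> applied to \<open>b x e\<close>, and a matrix and its
  adjoint have the same spectral norm.
\<close>

lemma norm_b_vector_le: "norm (b y *v e) \<le> spectral_norm (a x ** b y) * norm (b x *v e)"
proof -
  have "b y *v e = cadjoint (a x ** b y) *v (b x *v e)"
    by (simp add: cadjoint_mult cadjoint_a cadjoint_b a_b_vector flip: matrix_vector_mul_assoc)
  then show ?thesis using spectral_norm_cadjoint_bound by metis
qed

lemma g_le: "g e \<le> \<Phi> x * ennreal (norm (b x *v e) powr t')"
proof -
  have "g e \<le> (\<integral>\<^sup>+y. ennreal (spectral_norm (a x ** b y) powr t') * ennreal (norm (b x *v e) powr t') \<partial>M)"
    unfolding g_def
  proof (rule nn_integral_mono)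
    fix y
    have "norm (b y *v e) powr t' \<le> (spectral_norm (a x ** b y) * norm (b x *v e)) powr t'"
      using t'(1) by (intro powr_mono2 norm_b_vector_le) auto
    then show "ennreal (norm (b y *v e) powr t') \<le> ennreal (spectral_norm (a x ** b y) powr t') * ennreal (norm (b x *v e) powr t')"
      by (simp add: powr_mult flip: ennreal_mult)
  qed
  also have "\<dots> = \<Phi> x * ennreal (norm (b x *v e) powr t')"
    unfolding \<Phi>_def by (rule nn_integral_multc) measurable
  finally show ?thesis .
qed

text \<open>
  A lower bound for \<open>g\<close>, from \<open>e = (a y) (b y) e\<close> and Hoelder's inequality; the first factor is
  finite by local integrability of the weight.
\<close>

lemma norm_le_g:
  "ennreal (norm e) \<le> ennpow (\<integral>\<^sup>+x. ennreal (spectral_norm (a x) powr t) \<partial>M) (1 / t) * ennpow (g e) (1 / t')"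
proof -
  have "ennreal (norm e) = (\<integral>\<^sup>+y. ennreal (norm e) \<partial>M)" by (simp add: emeasure_space)
  also have "\<dots> \<le> (\<integral>\<^sup>+y. ennreal (spectral_norm (a y)) * ennreal (norm (b y *v e)) \<partial>M)"
  proof (rule nn_integral_mono)
    fix y
    show "ennreal (norm e) \<le> ennreal (spectral_norm (a y)) * ennreal (norm (b y *v e))"
      using norm_matrix_vector_le_spectral[of "a y" "b y *v e"]
      by (simp add: a_b_vector flip: ennreal_mult)
  qed
  also have "\<dots> \<le> ennpow (\<integral>\<^sup>+y. ennpow (ennreal (spectral_norm (a y))) t \<partial>M) (1 / t)
      * ennpow (\<integral>\<^sup>+y. ennpow (ennreal (norm (b y *v e))) t' \<partial>M) (1 / t')"
    by (rule nn_integral_Hoelder[OF t t'(1) t'(3)]) measurable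
  finally show ?thesis by (simp add: g_def)
qed

lemma g_scale: "g (c *s e) = ennreal (cmod c powr t') * g e"
proof -
  have "g (c *s e) = (\<integral>\<^sup>+y. ennreal (cmod c powr t') * ennreal (norm (b y *v e) powr t') \<partial>M)"
    by (simp add: g_def vector_scalar_commute norm_vector_scale powr_mult ennreal_mult)
  also have "\<dots> = ennreal (cmod c powr t') * g e"
    unfolding g_def by (rule nn_integral_cmult) measurable
  finally show ?thesis .
qed

lemma closed_g_ball: "closed {e. g e \<le> 1}"
  unfolding closed_sequential_limits
proof (intro allI impI, elim conjE, simp)
  fix e :: "nat \<Rightarrow> complex ^ 'd" and l
  assume e: "\<forall>n. g (e n) \<le> 1" and l: "e \<longlonglongrightarrow> l"
  have lim: "(\<lambda>n. ennreal (norm (b y *v e n) powr t')) \<longlonglongrightarrow> ennreal (norm (b y *v l) powr t')" for y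
    using t'(1)
    by (intro tendsto_ennrealI tendsto_powr' tendsto_norm tendsto_const
        bounded_linear.tendsto[OF bounded_linear_matrix_vector l]) auto
  have "g l = (\<integral>\<^sup>+y. liminf (\<lambda>n. ennreal (norm (b y *v e n) powr t')) \<partial>M)"
    unfolding g_def using lim_imp_Liminf[OF _ lim] by simp
  also have "\<dots> \<le> liminf (\<lambda>n. g (e n))"
    unfolding g_def by (rule nn_integral_liminf) measurable
  also have "\<dots> \<le> 1"
    using e Liminf_mono[of "\<lambda>n. g (e n)" "\<lambda>_. 1" sequentially] by (simp add: Liminf_const)
  finally show "g l \<le> 1" .
qed

end

context weight_on_prob
begin

lemma ex_\<Phi>_finite:
  assumes "char_t \<noteq> top" shows "\<exists>x. \<Phi> x \<noteq> top"
proof (rule ccontr)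
  assume "\<not> ?thesis"
  then have "char_t = top" by (simp add: char_t_def emeasure_space)
  with assms show False by simp
qed

text \<open>
  If \<open>char_t\<close> is finite, then \<open>\<Phi> x\<close> is finite at some point \<open>x\<close>, and \<open>g\<close> to the power \<open>1 / t'\<close> is a
  norm, comparable to the Euclidean one. Auerbach coordinates of its unit ball linearise it: \<open>B\<close> is
  a reducing operator of \<open>g\<close>.
\<close>

lemma reducing_coordinates:
  assumes fin: "char_t \<noteq> top"
  shows "\<exists>N B :: complex ^ 'd ^ 'd. N ** B = mat 1 \<and> (\<forall>j. g (column j N) \<le> 1) \<and>
           (\<forall>e i. ennreal (cmod ((B *v e) $ i) powr t') \<le> g e)"
proof -
  obtain x where x: "\<Phi> x \<noteq> top" using ex_\<Phi>_finite[OF fin] by blast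
  then obtain \<phi> where \<phi>: "\<Phi> x = ennreal \<phi>" "0 \<le> \<phi>" by (metis ennreal_cases)
  obtain h where h: "(\<integral>\<^sup>+x. ennreal (spectral_norm (a x) powr t) \<partial>M) = ennreal h" "0 \<le> h"
    using nn_integral_norm_a_finite by (metis ennreal_cases top.not_eq_extremum)
  define c where "c = \<phi> * spectral_norm (b x) powr t'"
  have c: "0 \<le> c" using \<phi> by (simp add: c_def)
  have g_le_c: "g e \<le> ennreal (c * norm e powr t')" for e
  proof -
    have "g e \<le> \<Phi> x * ennreal (norm (b x *v e) powr t')" by (rule g_le)
    also have "\<dots> = ennreal (\<phi> * norm (b x *v e) powr t')" using \<phi> by (simp add: ennreal_mult)
    also have "\<dots> \<le> ennreal (\<phi> * (spectral_norm (b x) * norm e) powr t')"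
      using \<phi> t'(1) by (intro ennreal_leI mult_left_mono powr_mono2 norm_matrix_vector_le_spectral) auto
    finally show ?thesis by (simp add: c_def powr_mult mult.assoc)
  qed
  define S where "S = {e. g e \<le> 1}"
  have "norm e \<le> h powr (1 / t)" if "e \<in> S" for e
  proof -
    have "ennreal (norm e) \<le> ennpow (ennreal h) (1 / t) * ennpow (g e) (1 / t')"
      using norm_le_g[of e] h by simp
    also have "\<dots> \<le> ennpow (ennreal h) (1 / t) * ennpow (ennreal 1) (1 / t')"
      using that t'(1) by (intro mult_left_mono ennpow_mono) (auto simp: S_def)
    also have "\<dots> = ennreal (h powr (1 / t))" using h by simp
    finally show ?thesis by simp
  qed
  then have "bounded S" by (auto simp: bounded_iff)
  then have "compact S" using closed_g_ball by (simp add: compact_eq_bounded_closed S_def)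
  moreover define r where "r = (1 / (c + 1)) powr (1 / t')"
  moreover have "0 < r" using c by (simp add: r_def)
  moreover have "ball 0 r \<subseteq> S"
  proof
    fix e :: "complex ^ 'd" assume "e \<in> ball 0 r"
    then have "norm e powr t' \<le> r powr t'" using t'(1) by (intro powr_mono2) auto
    also have "\<dots> = 1 / (c + 1)" using c t'(1) by (simp add: r_def powr_powr)
    finally have "c * norm e powr t' \<le> c * (1 / (c + 1))" using c by (rule mult_left_mono)
    also have "\<dots> \<le> 1" using c by simp
    finally have "ennreal (c * norm e powr t') \<le> ennreal 1" by (rule ennreal_leI)
    with g_le_c[of e] have "g e \<le> ennreal 1" by (rule order_trans)
    then show "e \<in> S" by (simp add: S_def)
  qed
  ultimately obtain N B :: "complex ^ 'd ^ 'd" where NB: "N ** B = mat 1" "\<And>j. column j N \<in> S"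
    "\<And>e i. e \<in> S \<Longrightarrow> cmod ((B *v e) $ i) \<le> 1"
    using auerbach_coordinates[of S r] by blast
  have "ennreal (cmod ((B *v e) $ i) powr t') \<le> g e" for e i
  proof (cases "e = 0")
    case False
    have "g e \<noteq> 0" using norm_le_g[of e] False by auto
    moreover have "g e \<noteq> top" using g_le_c[of e] by (auto simp: top_unique)
    ultimately obtain \<gamma> where \<gamma>: "g e = ennreal \<gamma>" "0 < \<gamma>"
      by (metis ennreal_cases ennreal_0 order_le_less)
    define z where "z = complex_of_real (\<gamma> powr (- (1 / t')))"
    have z: "cmod z = \<gamma> powr (- (1 / t'))" by (simp add: z_def)
    have "cmod z powr t' = 1 / \<gamma>"
      using \<gamma> t'(1) unfolding z powr_powr by (simp add: powr_minus_divide)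
    then have "g (z *s e) = 1"
      using \<gamma> by (simp add: g_scale flip: ennreal_mult)
    then have "cmod ((B *v (z *s e)) $ i) \<le> 1" using NB(3) by (simp add: S_def)
    then have "\<gamma> powr (- (1 / t')) * cmod ((B *v e) $ i) \<le> 1"
      by (simp add: vector_scalar_commute norm_mult z)
    then have "cmod ((B *v e) $ i) \<le> \<gamma> powr (1 / t')"
      using \<gamma>(2) by (simp add: powr_minus field_simps)
    then have "cmod ((B *v e) $ i) powr t' \<le> (\<gamma> powr (1 / t')) powr t'"
      using t'(1) by (intro powr_mono2) auto
    then show ?thesis using \<gamma> t'(1) by (simp add: powr_powr ennreal_leI)
  qed simp
  then show ?thesis using NB by (auto simp: S_def)
qed

text \<open>
  Expand \<open>e\<close> in the columns of \<open>N\<close>, which have \<open>g\<close>-size at most one.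
\<close>

lemma g_le_sum_coordinates:
  fixes N B :: "complex ^ 'd ^ 'd"
  assumes "N ** B = mat 1" "\<And>j. g (column j N) \<le> 1"
  shows "g e \<le> ennreal (real CARD('d) powr t') * (\<Sum>i\<in>UNIV. ennreal (cmod ((B *v e) $ i) powr t'))"
proof -
  have e: "e = (\<Sum>i\<in>UNIV. (B *v e) $ i *s column i N)"
    using matrix_mult_sum[of N "B *v e"] assms(1) by (simp add: matrix_vector_mul_assoc)
  have "g e \<le> (\<integral>\<^sup>+y. ennreal (real CARD('d) powr t') *
      (\<Sum>i\<in>UNIV. ennreal (cmod ((B *v e) $ i) powr t') * ennreal (norm (b y *v column i N) powr t')) \<partial>M)"
    unfolding g_def
  proof (rule nn_integral_mono)
    fix y
    have "b y *v e = (\<Sum>i\<in>UNIV. (B *v e) $ i *s (b y *v column i N))"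
      by (subst e) (simp add: linear_sum[OF linear_matrix_vector] vector_scalar_commute)
    then have "norm (b y *v e) \<le> (\<Sum>i\<in>UNIV. cmod ((B *v e) $ i) * norm (b y *v column i N))"
      by (metis (no_types, lifting) norm_sum norm_vector_scale sum.cong)
    then have "ennreal (norm (b y *v e)) \<le> (\<Sum>i\<in>UNIV. ennreal (cmod ((B *v e) $ i) * norm (b y *v column i N)))"
      by (simp add: ennreal_leI)
    then have "ennpow (ennreal (norm (b y *v e))) t' \<le> ennpow (\<Sum>i\<in>UNIV. ennreal (cmod ((B *v e) $ i) * norm (b y *v column i N))) t'"
      using t'(1) by (intro ennpow_mono) auto
    also have "\<dots> \<le> ennreal (real CARD('d) powr t') * (\<Sum>i\<in>UNIV. ennpow (ennreal (cmod ((B *v e) $ i) * norm (b y *v column i N))) t')"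
      using t'(1) by (intro ennpow_sum_le) auto
    finally show "ennreal (norm (b y *v e) powr t') \<le> ennreal (real CARD('d) powr t') *
      (\<Sum>i\<in>UNIV. ennreal (cmod ((B *v e) $ i) powr t') * ennreal (norm (b y *v column i N) powr t'))"
      by (simp add: powr_mult ennreal_mult ennpow_mult)
  qed
  also have "\<dots> = ennreal (real CARD('d) powr t') * (\<Sum>i\<in>UNIV. ennreal (cmod ((B *v e) $ i) powr t') * g (column i N))"
    by (simp add: nn_integral_cmult nn_integral_sum g_def del: sum_ennreal)
  also have "\<dots> \<le> ennreal (real CARD('d) powr t') * (\<Sum>i\<in>UNIV. ennreal (cmod ((B *v e) $ i) powr t') * 1)"
    by (intro mult_left_mono sum_mono assms(2)) auto
  finally show ?thesis by simp
qed

lemma \<Phi>_le_sum_g: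
  "\<Phi> x \<le> ennreal (real CARD('d) powr t') * (\<Sum>j\<in>UNIV. g (a x *v axis j 1))"
proof -
  have "\<Phi> x \<le> (\<integral>\<^sup>+y. ennreal (real CARD('d) powr t') * (\<Sum>j\<in>UNIV. ennreal (norm (b y *v (a x *v axis j 1)) powr t')) \<partial>M)"
    unfolding \<Phi>_def
  proof (rule nn_integral_mono)
    fix y
    have "spectral_norm (a x ** b y) \<le> (\<Sum>j\<in>UNIV. norm (b y *v (a x *v axis j 1)))"
      using spectral_norm_le_sum_axis[of "a x ** b y"]
      by (simp add: cadjoint_mult cadjoint_a cadjoint_b matrix_vector_mul_assoc)
    then have "ennreal (spectral_norm (a x ** b y)) \<le> (\<Sum>j\<in>UNIV. ennreal (norm (b y *v (a x *v axis j 1))))"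
      by (simp add: ennreal_leI)
    then have "ennpow (ennreal (spectral_norm (a x ** b y))) t' \<le> ennpow (\<Sum>j\<in>UNIV. ennreal (norm (b y *v (a x *v axis j 1)))) t'"
      using t'(1) by (intro ennpow_mono) auto
    also have "\<dots> \<le> ennreal (real CARD('d) powr t') * (\<Sum>j\<in>UNIV. ennpow (ennreal (norm (b y *v (a x *v axis j 1)))) t')"
      using t'(1) by (intro ennpow_sum_le) auto
    finally show "ennreal (spectral_norm (a x ** b y) powr t')
        \<le> ennreal (real CARD('d) powr t') * (\<Sum>j\<in>UNIV. ennreal (norm (b y *v (a x *v axis j 1)) powr t'))"
      by simp
  qed
  also have "\<dots> = ennreal (real CARD('d) powr t') * (\<Sum>j\<in>UNIV. g (a x *v axis j 1))"
    by (simp add: nn_integral_cmult nn_integral_sum g_def del: sum_ennreal)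
  finally show ?thesis .
qed

text \<open>
  The rows of a reducing operator give the test directions \<open>v i\<close> for the reverse Hoelder
  condition: they satisfy \<open>\<Phi> x \<lesssim> (\<Sum>i. \<bar>a x (v i)\<bar>\<^sup>t')\<close> and \<open>\<bar>a x (v i)\<bar>\<^sup>t' \<le> \<Phi> x\<close> for all \<open>x\<close>,
  so that \<open>char_st\<close> is controlled by the integrals \<open>J (v i)\<close>, and \<open>char_t\<close> controls \<open>I (v i)\<close>.
\<close>

lemma test_directions:
  assumes fin: "char_t \<noteq> top"
  obtains v :: "'d \<Rightarrow> complex ^ 'd" where
    "\<And>x. \<Phi> x \<le> ennreal (real CARD('d) powr t' * real CARD('d) powr t' * real CARD('d)) *
        (\<Sum>i\<in>UNIV. ennreal (norm (a x *v v i) powr t'))"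
    "\<And>x i. ennreal (norm (a x *v v i) powr t') \<le> \<Phi> x"
proof -
  obtain N B :: "complex ^ 'd ^ 'd" where NB: "N ** B = mat 1" "\<And>j. g (column j N) \<le> 1"
    "\<And>e i. ennreal (cmod ((B *v e) $ i) powr t') \<le> g e"
    using reducing_coordinates[OF fin] by blast
  define v where "v i = cadjoint B *v axis i 1" for i
  have coord: "cmod ((B *v (a x *v e)) $ i) = cmod (herm e (a x *v v i))" for x e i
    by (simp add: cmod_matrix_vector_nth v_def herm_matrix cadjoint_a)
  let ?d = "real CARD('d)"
  have "\<Phi> x \<le> ennreal (?d powr t' * ?d powr t' * ?d) * (\<Sum>i\<in>UNIV. ennreal (norm (a x *v v i) powr t'))" for x
  proof -
    have g_axis: "g (a x *v axis j 1) \<le> ennreal (?d powr t') * (\<Sum>i\<in>UNIV. ennreal (norm (a x *v v i) powr t'))" for j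
    proof -
      have "g (a x *v axis j 1) \<le> ennreal (?d powr t') * (\<Sum>i\<in>UNIV. ennreal (cmod ((B *v (a x *v axis j 1)) $ i) powr t'))"
        by (rule g_le_sum_coordinates[OF NB(1,2)])
      also have "\<dots> \<le> ennreal (?d powr t') * (\<Sum>i\<in>UNIV. ennreal (norm (a x *v v i) powr t'))"
      proof (intro mult_left_mono sum_mono ennreal_leI powr_mono2)
        show "cmod ((B *v (a x *v axis j 1)) $ i) \<le> norm (a x *v v i)" for i
          unfolding coord using cmod_herm_le[of "axis j 1" "a x *v v i"] by (simp add: norm_axis_one)
      qed (use t'(1) in auto)
      finally show ?thesis .
    qed
    have "\<Phi> x \<le> ennreal (?d powr t') * (\<Sum>j\<in>(UNIV::'d set). g (a x *v axis j 1))"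
      by (rule \<Phi>_le_sum_g)
    also have "\<dots> \<le> ennreal (?d powr t') * (\<Sum>j\<in>(UNIV::'d set). ennreal (?d powr t') * (\<Sum>i\<in>UNIV. ennreal (norm (a x *v v i) powr t')))"
      by (intro mult_left_mono sum_mono g_axis) auto
    also have "\<dots> = ennreal (?d powr t' * ?d powr t' * ?d) * (\<Sum>i\<in>UNIV. ennreal (norm (a x *v v i) powr t'))"
      by (simp add: ennreal_mult ennreal_of_nat_eq_real_of_nat mult_ac del: sum_ennreal)
    finally show ?thesis .
  qed
  \<comment> \<open>Testing the coordinate bound on \<open>a x f\<close> with \<open>f = a x (v i)\<close> makes the coordinate equal to \<open>\<bar>f\<bar>\<^sup>2\<close>.\<close>
  moreover have "ennreal (norm (a x *v v i) powr t') \<le> \<Phi> x" for x i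
  proof (cases "a x *v v i = 0")
    case False
    let ?f = "a x *v v i"
    have "ennreal (norm ?f powr t') * ennreal (norm ?f powr t') = ennreal (cmod ((B *v (a x *v ?f)) $ i) powr t')"
      by (simp add: coord herm_self power2_eq_square norm_mult powr_mult flip: ennreal_mult)
    also have "\<dots> \<le> g (a x *v ?f)" by (rule NB(3))
    also have "\<dots> \<le> \<Phi> x * ennreal (norm ?f powr t')"
      using g_le[of "a x *v ?f" x] by (simp add: b_a_vector)
    finally have "ennreal (norm ?f powr t') * ennreal (norm ?f powr t') \<le> ennreal (norm ?f powr t') * \<Phi> x"
      by (simp only: mult.commute[of "\<Phi> x"])
    then show ?thesis
      using False by (subst (asm) ennreal_mult_le_mult_iff) auto
  qed simp
  ultimately show ?thesis by (rule that)
qed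

lemma char_st_le_sum_J:
  assumes fin: "char_t \<noteq> top"
  obtains v :: "'d \<Rightarrow> complex ^ 'd" where "\<And>i. I (v i) \<le> char_t"
    "char_st \<le> ennreal ((real CARD('d) powr t' * real CARD('d) powr t' * real CARD('d) * real CARD('d)) powr (s * t / t')) * (\<Sum>i\<in>UNIV. J (v i))"
proof -
  let ?d = "real CARD('d)"
  let ?c = "?d powr t' * ?d powr t' * ?d"
  let ?r = "s * t / t'"
  obtain v :: "'d \<Rightarrow> complex ^ 'd" where v:
    "\<And>x. \<Phi> x \<le> ennreal ?c * (\<Sum>i\<in>UNIV. ennreal (norm (a x *v v i) powr t'))"
    "\<And>x i. ennreal (norm (a x *v v i) powr t') \<le> \<Phi> x"
    using test_directions[OF fin] by blast
  have r: "0 \<le> ?r" "t' * ?r = t * s" using t s t'(1) by auto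
  have "I (v i) \<le> char_t" for i
    unfolding I_def char_t_def
  proof (rule nn_integral_mono)
    fix x
    have "ennreal (norm (a x *v v i) powr t) = ennpow (ennreal (norm (a x *v v i) powr t')) (t / t')"
      using t'(1) by (simp add: powr_powr)
    also have "\<dots> \<le> ennpow (\<Phi> x) (t / t')"
      using t t'(1) by (intro ennpow_mono v(2)) auto
    finally show "ennreal (norm (a x *v v i) powr t) \<le> ennpow (\<Phi> x) (t / t')" .
  qed
  moreover have "char_st \<le> (\<integral>\<^sup>+x. ennreal ((?c * ?d) powr ?r) * (\<Sum>i\<in>UNIV. ennreal ((norm (a x *v v i) powr t) powr s)) \<partial>M)"
    unfolding char_st_def
  proof (rule nn_integral_mono)
    fix x
    have "ennpow (\<Phi> x) ?r \<le> ennpow (ennreal ?c * (\<Sum>i\<in>UNIV. ennreal (norm (a x *v v i) powr t'))) ?r"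
      using r by (intro ennpow_mono v(1)) auto
    also have "\<dots> = ennreal (?c powr ?r) * ennpow (\<Sum>i\<in>UNIV. ennreal (norm (a x *v v i) powr t')) ?r"
      by (simp add: ennpow_mult del: sum_ennreal)
    also have "\<dots> \<le> ennreal (?c powr ?r) * (ennreal (?d powr ?r) * (\<Sum>i\<in>UNIV. ennpow (ennreal (norm (a x *v v i) powr t')) ?r))"
      using r by (intro mult_left_mono ennpow_sum_le) auto
    also have "\<dots> = ennreal ((?c * ?d) powr ?r) * (\<Sum>i\<in>UNIV. ennreal ((norm (a x *v v i) powr t) powr s))"
      by (simp add: powr_powr r(2) powr_mult ennreal_mult mult.assoc del: sum_ennreal times_divide_eq_right)
    finally show "ennpow (\<Phi> x) ?r \<le> ennreal ((?c * ?d) powr ?r) * (\<Sum>i\<in>UNIV. ennreal ((norm (a x *v v i) powr t) powr s))" .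
  qed
  moreover have "\<dots> = ennreal ((?c * ?d) powr ?r) * (\<Sum>i\<in>UNIV. J (v i))"
    unfolding J_def by (subst nn_integral_cmult) (auto simp: nn_integral_sum simp del: sum_ennreal)
  ultimately show ?thesis using that[of v] by simp
qed

text \<open>
  For finite \<open>char_t\<close> the bound follows direction by direction from \<open>J e = (rh e * I e)\<^sup>s\<close>. If
  \<open>char_t\<close> is infinite, so is the right-hand side, because \<open>\<rho>\<close> is positive by Jensen's inequality.
\<close>

lemma char_st_le:
  assumes rh: "\<And>e. e \<noteq> 0 \<Longrightarrow> rh e \<le> \<rho>"
  shows "char_st \<le> ennreal (upper_const CARD('d) t s) * ennpow (char_t * \<rho>) s"
proof (cases "char_t = top")
  case True
  have "axis i 1 \<noteq> (0 :: complex ^ 'd)" for i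
    using norm_axis_one[of i] by force
  then have "\<rho> \<noteq> 0" using rh rh_nonzero by (metis le_zero_eq)
  moreover have "0 < upper_const CARD('d) t s" by (simp add: upper_const_pos)
  ultimately show ?thesis using True by (simp add: ennreal_top_mult ennreal_mult_top)
next
  case False
  let ?d = "real CARD('d)"
  let ?k = "(?d powr t' * ?d powr t' * ?d * ?d) powr (s * t / t')"
  obtain v :: "'d \<Rightarrow> complex ^ 'd" where v: "\<And>i. I (v i) \<le> char_t"
    "char_st \<le> ennreal ?k * (\<Sum>i\<in>UNIV. J (v i))"
    using char_st_le_sum_J[OF False] by blast
  have "J (v i) \<le> ennpow (char_t * \<rho>) s" for i
  proof (cases "v i = 0")
    case True
    then show ?thesis by (simp add: J_def)
  next
    case nz: False
    have "J (v i) = ennpow (rh (v i) * I (v i)) s" by (rule J_eq[OF nz])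
    also have "\<dots> \<le> ennpow (\<rho> * char_t) s"
      using s by (intro ennpow_mono mult_mono rh[OF nz] v(1)) auto
    finally show ?thesis by (simp add: mult.commute)
  qed
  then have "(\<Sum>i\<in>UNIV. J (v i)) \<le> (\<Sum>i\<in>(UNIV::'d set). ennpow (char_t * \<rho>) s)"
    by (intro sum_mono)
  then have "char_st \<le> ennreal ?k * (\<Sum>i\<in>(UNIV::'d set). ennpow (char_t * \<rho>) s)"
    using v(2) by (meson mult_left_mono order_trans zero_le)
  also have "\<dots> = ennreal (upper_const CARD('d) t s) * ennpow (char_t * \<rho>) s"
    by (simp add: upper_const_def ennreal_mult ennreal_of_nat_eq_real_of_nat mult.assoc)
  finally show ?thesis .
qed

end

section \<open>Averages over cubes\<close>

lemma cube_measure: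
  assumes "Q \<in> cubes n"
  shows "Q \<in> sets (lebesgue_dim n)" "emeasure (lebesgue_dim n) Q \<noteq> 0" "emeasure (lebesgue_dim n) Q \<noteq> top"
proof -
  obtain a h where Q: "0 < h" "Q = (\<Pi>\<^sub>E i\<in>{..<n}. {a i .. a i + h})"
    using assms by (auto simp: cubes_def)
  interpret product_sigma_finite "\<lambda>_ :: nat. lborel :: real measure" by standard
  have sets: "Q \<in> sets (\<Pi>\<^sub>M i\<in>{..<n}. (lborel :: real measure))"
    unfolding Q(2) by (intro sets_PiM_I_finite) auto
  then show "Q \<in> sets (lebesgue_dim n)" by (simp add: lebesgue_dim_def)
  have "emeasure (lebesgue_dim n) Q = (\<Prod>i<n. emeasure lborel {a i .. a i + h})"
    using sets unfolding lebesgue_dim_def Q(2) by (simp add: emeasure_PiM)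
  also have "\<dots> = ennreal (h ^ n)" using Q(1) by (simp add: ennreal_power)
  finally have "emeasure (lebesgue_dim n) Q = ennreal (h ^ n)" .
  then show "emeasure (lebesgue_dim n) Q \<noteq> 0" "emeasure (lebesgue_dim n) Q \<noteq> top"
    using Q(1) by (simp_all add: ennreal_eq_0_iff not_le)
qed

lemma cube_avg_eq_nn_integral:
  assumes Q: "Q \<in> cubes n" and f': "f' \<in> borel_measurable (lebesgue_dim n)"
    and eq: "AE x in lebesgue_dim n. x \<in> Q \<longrightarrow> f x = f' x"
  shows "cube_avg n Q f = (\<integral>\<^sup>+x. f' x \<partial>uniform_measure (lebesgue_dim n) Q)"
proof -
  have "(\<integral>\<^sup>+x\<in>Q. f x \<partial>lebesgue_dim n) = (\<integral>\<^sup>+x\<in>Q. f' x \<partial>lebesgue_dim n)"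
    using eq by (intro nn_integral_cong_AE) (auto elim!: eventually_mono split: split_indicator)
  then show ?thesis
    unfolding cube_avg_def by (subst nn_integral_uniform_measure[OF f' cube_measure(1)[OF Q]]) simp
qed

definition Apq_avg :: "nat \<Rightarrow> real \<Rightarrow> real \<Rightarrow> ((nat \<Rightarrow> real) \<Rightarrow> complex ^ 'd ^ 'd) \<Rightarrow> (nat \<Rightarrow> real) set \<Rightarrow> ennreal" where
  "Apq_avg n p q V Q = cube_avg n Q (\<lambda>x. ennpow (cube_avg n Q (\<lambda>y.
      ennreal (spectral_norm (mat_rpow (V x) (1 / q) ** mat_rpow (V y) (- 1 / q)) powr conj_exp p))) (q / conj_exp p))"

definition RH_quotient :: "nat \<Rightarrow> real \<Rightarrow> ((nat \<Rightarrow> real) \<Rightarrow> real) \<Rightarrow> (nat \<Rightarrow> real) set \<Rightarrow> ennreal" where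
  "RH_quotient n s w Q =
     ennpow (cube_avg n Q (\<lambda>x. ennreal (w x powr s))) (1 / s) / cube_avg n Q (\<lambda>x. ennreal (w x))"

text \<open>
  Redefining \<open>W\<close> to be the identity matrix off the cube and where it is not positive definite makes
  it integrable and positive definite everywhere, and changes no average over the cube.
\<close>

definition cube_weight :: "(nat \<Rightarrow> real) set \<Rightarrow> ((nat \<Rightarrow> real) \<Rightarrow> complex ^ 'd ^ 'd) \<Rightarrow> (nat \<Rightarrow> real) \<Rightarrow> complex ^ 'd ^ 'd" where
  "cube_weight Q W x = (if x \<in> Q \<and> pos_def (W x) then W x else mat 1)"

lemma measurable_pos_def:
  assumes "matrix_weight n W"
  shows "Measurable.pred (lebesgue_dim n) (\<lambda>x. pos_def (W x))"
proof -
  have "AE x in (\<Pi>\<^sub>M i\<in>{..<n}. lborel). \<not> \<not> pos_def (W x)"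
    using assms unfolding matrix_weight_def lebesgue_dim_def AE_completion_iff by simp
  from pred_intros_logic(2)[OF sets_completion_AE[OF this]] show ?thesis
    by (simp add: lebesgue_dim_def)
qed

lemma weight_on_cube:
  assumes W: "matrix_weight n W" and Q: "Q \<in> cubes n" and "1 < t" "1 < s"
  shows "weight_on_prob (uniform_measure (lebesgue_dim n) Q) (cube_weight Q W) t s"
proof
  let ?L = "lebesgue_dim n" and ?W = "cube_weight Q W"
  note cube = cube_measure[OF Q]
  have int: "integrable ?L (\<lambda>x. indicator Q x *\<^sub>R W x)"
    using W Q by (simp add: matrix_weight_def set_integrable_def)
  note [measurable] = borel_measurable_integrable[OF int] measurable_pos_def[OF W] cube(1)
  have W_eq: "?W = (\<lambda>x. if x \<in> Q \<and> pos_def (W x) then indicator Q x *\<^sub>R W x else mat 1)"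
    by (auto simp: cube_weight_def)
  have meas: "?W \<in> borel_measurable ?L"
    unfolding W_eq by measurable
  show "emeasure (uniform_measure ?L Q) (space (uniform_measure ?L Q)) = 1"
    using emeasure_uniform_measure_1[OF cube(2)] cube(3) cube(1)
    by (simp add: Int_absorb2 sets.sets_into_space ennreal_divide_self top.not_eq_extremum)
  show "integrable (uniform_measure ?L Q) ?W"
  proof (rule integrableI_bounded)
    show "?W \<in> borel_measurable (uniform_measure ?L Q)" using meas by simp
    have "(\<integral>\<^sup>+x. ennreal (norm (?W x)) \<partial>uniform_measure ?L Q)
        = (\<integral>\<^sup>+x. ennreal (norm (?W x)) * indicator Q x \<partial>?L) / emeasure ?L Q"
      using meas cube(1) by (intro nn_integral_uniform_measure) measurable
    also have "(\<integral>\<^sup>+x. ennreal (norm (?W x)) * indicator Q x \<partial>?L) = (\<integral>\<^sup>+x. ennreal (norm (indicator Q x *\<^sub>R W x)) \<partial>?L)"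
    proof (rule nn_integral_cong_AE)
      have "AE x in ?L. pos_def (W x)" using W by (simp add: matrix_weight_def)
      then show "AE x in ?L. ennreal (norm (?W x)) * indicator Q x = ennreal (norm (indicator Q x *\<^sub>R W x))"
        by eventually_elim (auto simp: cube_weight_def split: split_indicator)
    qed
    also have "\<dots> / emeasure ?L Q < top"
      using int cube(2) by (simp add: integrable_iff_bounded ennreal_divide_eq_top_iff top.not_eq_extremum[symmetric])
    finally show "(\<integral>\<^sup>+x. ennreal (norm (?W x)) \<partial>uniform_measure ?L Q) < \<infinity>" by simp
  qed
  show "pos_def (?W x)" for x by (simp add: cube_weight_def pos_def_mat_1)
qed fact+

context
  fixes n :: nat and W :: "(nat \<Rightarrow> real) \<Rightarrow> complex ^ 'd ^ 'd" and Q and t s :: real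
  assumes W: "matrix_weight n W" and Q: "Q \<in> cubes n" and ts: "1 < t" "1 < s"
begin

interpretation weight_on_prob "uniform_measure (lebesgue_dim n) Q" "cube_weight Q W" t s
  by (rule weight_on_cube[OF W Q ts])

lemma AE_pos_def: "AE x in lebesgue_dim n. pos_def (W x)"
  using W by (simp add: matrix_weight_def)

lemma Apq_avg_eq:
  assumes V: "\<And>x. pos_def (W x) \<Longrightarrow> mat_rpow (V x) (1 / q) = mat_rpow (W x) (1 / t)"
    "\<And>x. pos_def (W x) \<Longrightarrow> mat_rpow (V x) (- 1 / q) = mat_rpow (W x) (- (1 / t))"
  shows "Apq_avg n t q V Q = (\<integral>\<^sup>+x. ennpow (\<Phi> x) (q / t') \<partial>uniform_measure (lebesgue_dim n) Q)"
  unfolding Apq_avg_def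
proof (rule cube_avg_eq_nn_integral[OF Q])
  show "(\<lambda>x. ennpow (\<Phi> x) (q / t')) \<in> borel_measurable (lebesgue_dim n)"
    using measurable_\<Phi> by simp
  have ab: "mat_rpow (V x) (1 / q) = a x" "mat_rpow (V x) (- 1 / q) = b x" if "pos_def (W x)" "x \<in> Q" for x
    using that V by (simp_all add: a_def b_def cube_weight_def)
  have "cube_avg n Q (\<lambda>y. ennreal (spectral_norm (mat_rpow (V x) (1 / q) ** mat_rpow (V y) (- 1 / q)) powr t')) = \<Phi> x"
    if x: "pos_def (W x)" "x \<in> Q" for x
    unfolding \<Phi>_def
  proof (rule cube_avg_eq_nn_integral[OF Q])
    have "(\<lambda>y. ennreal (spectral_norm (a x ** b y) powr t')) \<in> borel_measurable (uniform_measure (lebesgue_dim n) Q)"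
      by measurable
    then show "(\<lambda>y. ennreal (spectral_norm (a x ** b y) powr t')) \<in> borel_measurable (lebesgue_dim n)" by simp
    show "AE y in lebesgue_dim n. y \<in> Q \<longrightarrow>
        ennreal (spectral_norm (mat_rpow (V x) (1 / q) ** mat_rpow (V y) (- 1 / q)) powr t')
        = ennreal (spectral_norm (a x ** b y) powr t')"
      using AE_pos_def
    proof eventually_elim
      case (elim y)
      show ?case by (simp only: ab(1)[OF x] ab(2)[OF elim] simp_thms cong: imp_cong)
    qed
  qed
  then show "AE x in lebesgue_dim n. x \<in> Q \<longrightarrow>
      ennpow (cube_avg n Q (\<lambda>y. ennreal (spectral_norm (mat_rpow (V x) (1 / q) ** mat_rpow (V y) (- 1 / q)) powr t'))) (q / t')
      = ennpow (\<Phi> x) (q / t')"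
    using AE_pos_def by (auto elim!: eventually_mono)
qed

lemma Ap_avg_eq: "Apq_avg n t t W Q = char_t"
  unfolding char_t_def by (rule Apq_avg_eq) simp_all

lemma Apq_avg_power_eq: "Apq_avg n t (s * t) (\<lambda>x. mat_rpow (W x) s) Q = char_st"
  unfolding char_st_def by (rule Apq_avg_eq) (use ts in \<open>simp_all add: mat_rpow_mat_rpow\<close>)

lemma RH_quotient_eq: "RH_quotient n s (\<lambda>x. norm (mat_rpow (W x) (1 / t) *v e) powr t) Q = rh e"
proof -
  have a: "mat_rpow (W x) (1 / t) = a x" if "pos_def (W x)" "x \<in> Q" for x
    using that by (simp add: a_def cube_weight_def)
  have "cube_avg n Q (\<lambda>x. ennreal ((norm (mat_rpow (W x) (1 / t) *v e) powr t) powr s)) = J e"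
    unfolding J_def
  proof (rule cube_avg_eq_nn_integral[OF Q])
    have "(\<lambda>x. ennreal ((norm (a x *v e) powr t) powr s)) \<in> borel_measurable (uniform_measure (lebesgue_dim n) Q)"
      by measurable
    then show "(\<lambda>x. ennreal ((norm (a x *v e) powr t) powr s)) \<in> borel_measurable (lebesgue_dim n)" by simp
  qed (use AE_pos_def in eventually_elim, simp add: a)
  moreover have "cube_avg n Q (\<lambda>x. ennreal (norm (mat_rpow (W x) (1 / t) *v e) powr t)) = I e"
    unfolding I_def
  proof (rule cube_avg_eq_nn_integral[OF Q])
    have "(\<lambda>x. ennreal (norm (a x *v e) powr t)) \<in> borel_measurable (uniform_measure (lebesgue_dim n) Q)"
      by measurable
    then show "(\<lambda>x. ennreal (norm (a x *v e) powr t)) \<in> borel_measurable (lebesgue_dim n)" by simp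
  qed (use AE_pos_def in eventually_elim, simp add: a)
  ultimately show ?thesis by (simp add: RH_quotient_def rh_def)
qed

lemma cube_estimates:
  shows "ennpow (Apq_avg n t t W Q) s \<le> Apq_avg n t (s * t) (\<lambda>x. mat_rpow (W x) s) Q"
    and "ennpow (RH_quotient n s (\<lambda>x. norm (mat_rpow (W x) (1 / t) *v e) powr t) Q) s
      \<le> Apq_avg n t (s * t) (\<lambda>x. mat_rpow (W x) s) Q"
    and "(\<And>e. e \<noteq> 0 \<Longrightarrow> RH_quotient n s (\<lambda>x. norm (mat_rpow (W x) (1 / t) *v e) powr t) Q \<le> \<rho>) \<Longrightarrow>
      Apq_avg n t (s * t) (\<lambda>x. mat_rpow (W x) s) Q
      \<le> ennreal (upper_const CARD('d) t s) * ennpow (Apq_avg n t t W Q * \<rho>) s"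
  unfolding Ap_avg_eq Apq_avg_power_eq RH_quotient_eq
  by (rule ennpow_char_t_le ennpow_rh_le char_st_le; assumption?)+

end

section \<open>The two-sided estimate\<close>

lemma ennpow_le_iff:
  assumes "0 < s" shows "ennpow x s \<le> y \<longleftrightarrow> x \<le> ennpow y (1 / s)"
proof
  assume "ennpow x s \<le> y"
  then have "ennpow (ennpow x s) (1 / s) \<le> ennpow y (1 / s)" using assms by (intro ennpow_mono) auto
  then show "x \<le> ennpow y (1 / s)" using assms by (simp add: ennpow_ennpow)
next
  assume "x \<le> ennpow y (1 / s)"
  then have "ennpow x s \<le> ennpow (ennpow y (1 / s)) s" using assms by (intro ennpow_mono) auto
  then show "ennpow x s \<le> y" using assms by (simp add: ennpow_ennpow)
qed

theorem proposition1p4: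
  fixes t s :: real
  assumes "1 < t" and "1 < s"
  shows "\<exists>C\<^sub>1 > 0. \<exists>C\<^sub>2 > 0. \<forall>n \<ge> 1. \<forall>W :: (nat \<Rightarrow> real) \<Rightarrow> complex ^ 'd ^ 'd.
    matrix_weight n W \<longrightarrow>
      ennpow (max (Ap_char n t W) (matrix_RH_char n t s W)) s
        \<le> ennreal C\<^sub>1 * Apq_char n t (s * t) (\<lambda>x. mat_rpow (W x) s) \<and>
      Apq_char n t (s * t) (\<lambda>x. mat_rpow (W x) s)
        \<le> ennreal C\<^sub>2 * ennpow (Ap_char n t W * matrix_RH_char n t s W) s"
proof -
  have "ennpow (max (Ap_char n t W) (matrix_RH_char n t s W)) s
        \<le> ennreal 1 * Apq_char n t (s * t) (\<lambda>x. mat_rpow (W x) s) \<and>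
      Apq_char n t (s * t) (\<lambda>x. mat_rpow (W x) s)
        \<le> ennreal (upper_const CARD('d) t s) * ennpow (Ap_char n t W * matrix_RH_char n t s W) s"
    if W: "matrix_weight n W" for n and W :: "(nat \<Rightarrow> real) \<Rightarrow> complex ^ 'd ^ 'd"
  proof -
    let ?V = "\<lambda>x. mat_rpow (W x) s"
    let ?w = "\<lambda>e x. norm (mat_rpow (W x) (1 / t) *v e) powr t"
    have A: "Apq_char n p q V = (SUP Q\<in>cubes n. Apq_avg n p q V Q)" for p q and V :: "(nat \<Rightarrow> real) \<Rightarrow> complex ^ 'd ^ 'd"
      by (simp add: Apq_char_def Apq_avg_def)
    have R: "matrix_RH_char n t s W = (SUP e\<in>UNIV - {0}. SUP Q\<in>cubes n. RH_quotient n s (?w e) Q)"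
      by (simp add: matrix_RH_char_def RH_char_def RH_quotient_def)
    note est = cube_estimates[OF W _ assms]
    have s: "0 < s" using assms by simp
    let ?K = "Apq_char n t (s * t) ?V"
    have K: "Apq_avg n t (s * t) ?V Q \<le> ?K" if "Q \<in> cubes n" for Q
      unfolding A using that by (rule SUP_upper)
    have "Ap_char n t W \<le> ennpow ?K (1 / s)"
      unfolding A[of t t W]
    proof (rule SUP_least)
      fix Q assume Q: "Q \<in> cubes n"
      show "Apq_avg n t t W Q \<le> ennpow ?K (1 / s)"
        unfolding ennpow_le_iff[OF s, symmetric] by (rule order_trans[OF est(1)[OF Q] K[OF Q]])
    qed
    moreover have "matrix_RH_char n t s W \<le> ennpow ?K (1 / s)"
      unfolding R
    proof (intro SUP_least)
      fix e Q assume Q: "Q \<in> cubes n"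
      show "RH_quotient n s (?w e) Q \<le> ennpow ?K (1 / s)"
        unfolding ennpow_le_iff[OF s, symmetric] by (rule order_trans[OF est(2)[OF Q] K[OF Q]])
    qed
    ultimately have "ennpow (max (Ap_char n t W) (matrix_RH_char n t s W)) s \<le> ?K"
      unfolding ennpow_le_iff[OF s] by simp
    moreover have "?K \<le> ennreal (upper_const CARD('d) t s) * ennpow (Ap_char n t W * matrix_RH_char n t s W) s"
      unfolding A[of t "s * t" ?V]
    proof (rule SUP_least)
      fix Q assume Q: "Q \<in> cubes n"
      have "Apq_avg n t (s * t) ?V Q
          \<le> ennreal (upper_const CARD('d) t s) * ennpow (Apq_avg n t t W Q * matrix_RH_char n t s W) s"
      proof (rule est(3)[OF Q])
        fix e :: "complex ^ 'd" assume "e \<noteq> 0"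
        then show "RH_quotient n s (?w e) Q \<le> matrix_RH_char n t s W"
          unfolding R using Q by (intro SUP_upper2[of e] SUP_upper) auto
      qed
      also have "\<dots> \<le> ennreal (upper_const CARD('d) t s) * ennpow (Ap_char n t W * matrix_RH_char n t s W) s"
        unfolding A[of t t W] using s Q by (intro mult_left_mono ennpow_mono mult_right_mono SUP_upper) auto
      finally show "Apq_avg n t (s * t) ?V Q
          \<le> ennreal (upper_const CARD('d) t s) * ennpow (Ap_char n t W * matrix_RH_char n t s W) s" .
    qed
    ultimately show ?thesis by simp
  qed
  moreover have "0 < upper_const (real CARD('d)) t s" by (rule upper_const_pos) simp
  ultimately show ?thesis using zero_less_one by blast
qed

end
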